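(* Let $n,k,d$ be integers with $k>d\geq 2$ and $n\geq 4(d-1)dk$. If $\mathcal{F}\subset\binom{[n]}{k}$ is intersecting and $|\mathcal{F}|\geq 2^d d^{2d+1}\binom{n-d-1}{k-d-1}$, then $\varrho(\mathcal{F})>\frac{1}{d}$.
   Context: $[n]=\{1,\ldots,n\}$ and $\binom{[n]}{k}$ is the collection of all $k$-element subsets of $[n]$. A family $\mathcal{F}$ is intersecting if $F\cap F'\neq\emptyset$ for all $F,F'\in\mathcal{F}$. For $i\in[n]$ put $\mathcal{F}(i)=\{F\setminus\{i\}: i\in F\in\mathcal{F}\}$, and for nonempty $\mathcal{F}$ put $\varrho(\mathcal{F})=\max_{1\leq i\leq n}|\mathcal{F}(i)|/|\mathcal{F}|$. *)

theory Defs
  imports Complex_Main "HOL-Library.Ramsey"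
begin

definition intersecting :: "'a set set \<Rightarrow> bool" where
  "intersecting \<F> \<longleftrightarrow> (\<forall>F\<in>\<F>. \<forall>F'\<in>\<F>. F \<inter> F' \<noteq> {})"

definition link :: "'a set set \<Rightarrow> 'a \<Rightarrow> 'a set set" where
  "link \<F> i = {F - {i} | F. F \<in> \<F> \<and> i \<in> F}"

(* Meaningful only for n \<ge> 1 and finite nonempty \<F>. *)
definition varrho :: "nat \<Rightarrow> nat set set \<Rightarrow> real" where
  "varrho n \<F> = Max ((\<lambda>i. real (card (link \<F> i)) / real (card \<F>)) ` {1..n})"

end

theory Submission
  imports Defs
begin

text \<open>
  Suppose that every point lies in at most \<open>|\<F>| / d\<close> members of \<open>\<F>\<close>, and let
  \<open>N = (n - d - 1 choose k - d - 1)\<close> be the number of \<open>k\<close>-sets that contain a given set of \<open>d + 1\<close>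
  points. The size of \<open>\<F>\<close> is bounded by \<open>d * (2 * d\<^sup>2) ^ d * N\<close>, with strict inequality, by
  showing that most members of (a modification of) \<open>\<F>\<close> contain one of few \<open>d\<close>-sets, and that each
  \<open>d\<close>-set lies in few members.

  A \<open>d\<close>-set \<open>S\<close> lies in at most \<open>(d + 1) * N\<close> members (\<open>card_over_d_set_le\<close>). By the
  degree bound the points of \<open>S\<close> have total degree at most \<open>|\<F>|\<close>, and the members that contain
  \<open>S\<close> are counted \<open>d\<close> times in it; so at least \<open>d - 1\<close> times as many members avoid \<open>S\<close>. The
  members over \<open>S\<close> and the members avoiding \<open>S\<close> are cross-intersecting outside \<open>S\<close>. After
  shifting both families outside \<open>S\<close>, more than \<open>(d + 1) * N\<close> members over \<open>S\<close> would include one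
  that misses the first \<open>d\<close> points and is sparse afterwards, and this forces all members of the other
  family to be so concentrated on initial segments that there are fewer than \<open>3 * N\<close> of them.

  Next, \<open>\<F>\<close> is shifted only as long as the degree bound survives. A shift that would break it
  exhibits two points of total degree above \<open>|\<F>| / d\<close>. Collecting disjoint such pairs gives a set
  \<open>X\<close> of points of average degree at least \<open>|\<F>| / (2 * d)\<close>. If \<open>X\<close> had
  \<open>2 * (d * (d - 1) + 1)\<close> points, members would meet it in more than \<open>d - 1\<close> points on average, hence
  contain many \<open>d\<close>-subsets of \<open>X\<close>, against the bound for \<open>d\<close>-sets (\<open>not_all_heavy\<close>). So
  \<open>X\<close> stops growing at \<open>2 * d * (d - 1)\<close> points at most, and the family is then shifted outside
  \<open>X\<close>.

  Finally let \<open>Y\<close> consist of \<open>X\<close> and the first \<open>2 * d\<close> points outside \<open>X\<close>, so that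
  \<open>|Y| \<le> 2 * d\<^sup>2\<close> (\<open>not_shifted_outside\<close>). If a member \<open>A\<close> met \<open>Y\<close> in fewer than \<open>d\<close>
  points without being dense on some later window, then all members avoiding \<open>A \<inter> Y\<close>, which are at
  least \<open>|\<F>| / d\<close> in number by the degree bound, would have to be dense or to have more than \<open>d\<close>
  points among the first \<open>2 * d\<close>; there are too few such sets. Hence all members but a few dense ones
  contain a \<open>d\<close>-subset of \<open>Y\<close>, and there are at most \<open>(2 * d\<^sup>2 choose d) * (d + 1) * N\<close> of those.

  The hypothesis \<open>4 * (d - 1) * d * k \<le> n\<close> enters through the counting of dense sets: a window of
  \<open>2 * j\<close> points offers about \<open>4 ^ j\<close> ways to place a majority, each further prescribed point
  costs a factor \<open>k / n\<close>, and \<open>4 * k / n \<le> 1 / (d * (d - 1)) \<le> 1 / 2\<close> makes the sum over \<open>j\<close>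
  a convergent geometric series.
\<close>

section \<open>Shifting\<close>

definition shift_set :: "nat \<Rightarrow> nat \<Rightarrow> nat set set \<Rightarrow> nat set \<Rightarrow> nat set" where
  "shift_set i j \<F> F =
    (if j \<in> F \<and> i \<notin> F \<and> insert i (F - {j}) \<notin> \<F> then insert i (F - {j}) else F)"

definition shift :: "nat \<Rightarrow> nat \<Rightarrow> nat set set \<Rightarrow> nat set set" where
  "shift i j \<F> = shift_set i j \<F> ` \<F>"

definition shifted_on :: "nat set \<Rightarrow> nat set set \<Rightarrow> bool" where
  "shifted_on R \<F> \<longleftrightarrow> (\<forall>F\<in>\<F>. \<forall>i\<in>R. \<forall>j\<in>R. i < j \<longrightarrow> j \<in> F \<longrightarrow> i \<notin> F \<longrightarrow> insert i (F - {j}) \<in> \<F>)"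

definition cross_intersecting :: "'a set set \<Rightarrow> 'a set set \<Rightarrow> bool" where
  "cross_intersecting \<A> \<B> \<longleftrightarrow> (\<forall>A\<in>\<A>. \<forall>B\<in>\<B>. A \<inter> B \<noteq> {})"

text \<open>
  A potential that a proper shift lowers: a family of least weight among the candidates is shifted.
\<close>

definition weight :: "nat set set \<Rightarrow> nat" where
  "weight \<F> = (\<Sum>F\<in>\<F>. \<Sum>F)"

lemma inj_on_shift_set: "inj_on (shift_set i j \<F>) \<F>"
proof (rule inj_onI)
  fix F G assume F: "F \<in> \<F>" and G: "G \<in> \<F>" and eq: "shift_set i j \<F> F = shift_set i j \<F> G"
  let ?m = "\<lambda>F. j \<in> F \<and> i \<notin> F \<and> insert i (F - {j}) \<notin> \<F>"
  consider "?m F" "?m G" | "?m F" "\<not> ?m G" | "\<not> ?m F" "?m G" | "\<not> ?m F" "\<not> ?m G" by blast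
  then show "F = G"
  proof cases
    case 1
    then have "insert i (F - {j}) = insert i (G - {j})"
      using eq by (simp add: shift_set_def)
    then have "F - {j} = G - {j}"
      using 1 insert_ident[of i "F - {j}" "G - {j}"] by simp
    then show ?thesis using 1 by blast
  qed (use F G eq in \<open>auto simp: shift_set_def split: if_splits\<close>)
qed

lemma card_shift: "card (shift i j \<F>) = card \<F>"
  unfolding shift_def by (rule card_image[OF inj_on_shift_set])

lemma mem_shift_set_other: "x \<noteq> i \<Longrightarrow> x \<noteq> j \<Longrightarrow> x \<in> shift_set i j \<F> F \<longleftrightarrow> x \<in> F"
  by (auto simp: shift_set_def)

lemma shift_set_in_nsets:
  assumes "F \<in> nsets V k" "i \<in> V"
  shows "shift_set i j \<F> F \<in> nsets V k"
proof (cases "j \<in> F \<and> i \<notin> F")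
  case True
  then have "card (insert i (F - {j})) = card F"
    using assms card_Suc_Diff1[of F j] by (simp add: nsets_def)
  with True show ?thesis using assms by (auto simp: shift_set_def nsets_def)
qed (use assms in \<open>auto simp: shift_set_def\<close>)

lemma shift_subset_nsets: "\<F> \<subseteq> nsets V k \<Longrightarrow> i \<in> V \<Longrightarrow> shift i j \<F> \<subseteq> nsets V k"
  by (auto simp: shift_def intro!: shift_set_in_nsets)

text \<open>
  The delicate case is a set \<open>A\<close> that moves and a set \<open>B\<close> that stays, with \<open>A \<inter> B = {j}\<close>. Then \<open>B\<close>
  stays only because its image is already present, and this image would miss \<open>A\<close>.
\<close>

lemma cross_intersecting_shift:
  assumes "cross_intersecting \<A> \<B>"
  shows "cross_intersecting (shift i j \<A>) (shift i j \<B>)"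
proof -
  have "shift_set i j \<A> A \<inter> shift_set i j \<B> B \<noteq> {}" if A: "A \<in> \<A>" and B: "B \<in> \<B>" for A B
  proof -
    have AB: "A \<inter> B \<noteq> {}" using assms A B by (auto simp: cross_intersecting_def)
    have A': "insert i (A - {j}) \<in> \<A> \<Longrightarrow> insert i (A - {j}) \<inter> B \<noteq> {}"
      using assms B unfolding cross_intersecting_def by blast
    have B': "insert i (B - {j}) \<in> \<B> \<Longrightarrow> A \<inter> insert i (B - {j}) \<noteq> {}"
      using assms A unfolding cross_intersecting_def by blast
    let ?a = "j \<in> A \<and> i \<notin> A \<and> insert i (A - {j}) \<notin> \<A>"
    let ?b = "j \<in> B \<and> i \<notin> B \<and> insert i (B - {j}) \<notin> \<B>"
    consider "?a" "?b" | "?a" "\<not> ?b" | "\<not> ?a" "?b" | "\<not> ?a" "\<not> ?b" by blast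
    then show ?thesis
    proof cases
      case 1
      then show ?thesis by (simp add: shift_set_def)
    next
      case 2
      then have "insert i (A - {j}) \<inter> B \<noteq> {}" using AB B' by blast
      with 2 show ?thesis unfolding shift_set_def by (simp only: if_True if_False simp_thms)
    next
      case 3
      then have "A \<inter> insert i (B - {j}) \<noteq> {}" using AB A' by blast
      with 3 show ?thesis unfolding shift_set_def by (simp only: if_True if_False simp_thms)
    next
      case 4
      then show ?thesis using AB unfolding shift_set_def by (simp only: if_True if_False simp_thms)
    qed
  qed
  then show ?thesis by (auto simp: cross_intersecting_def shift_def)
qed

lemma sum_shift_set:
  assumes "finite F" "i < j"
  shows "\<Sum>(shift_set i j \<F> F) \<le> \<Sum>F"
    and "shift_set i j \<F> F \<noteq> F \<Longrightarrow> \<Sum>(shift_set i j \<F> F) < \<Sum>F"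
proof -
  have "\<Sum>(insert i (F - {j})) < \<Sum>F" if "j \<in> F" "i \<notin> F"
    using that assms by (simp add: sum.remove[of F j])
  then show "\<Sum>(shift_set i j \<F> F) \<le> \<Sum>F"
    and "shift_set i j \<F> F \<noteq> F \<Longrightarrow> \<Sum>(shift_set i j \<F> F) < \<Sum>F"
    by (simp_all add: shift_set_def less_imp_le split: if_splits)
qed

lemma weight_shift_le:
  assumes "finite \<F>" "\<And>F. F \<in> \<F> \<Longrightarrow> finite F" "i < j"
  shows "weight (shift i j \<F>) \<le> weight \<F>"
  unfolding weight_def shift_def
  using sum_shift_set(1) assms by (simp add: sum.reindex[OF inj_on_shift_set] sum_mono)

lemma weight_shift_less:
  assumes "finite \<F>" "\<And>F. F \<in> \<F> \<Longrightarrow> finite F" "i < j"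
    and "F \<in> \<F>" "j \<in> F" "i \<notin> F" "insert i (F - {j}) \<notin> \<F>"
  shows "weight (shift i j \<F>) < weight \<F>"
proof -
  have "i \<in> shift_set i j \<F> F"
    using assms by (simp add: shift_set_def)
  then have "\<Sum>(shift_set i j \<F> F) < \<Sum>F"
    using assms by (intro sum_shift_set(2)) auto
  then have "(\<Sum>F\<in>\<F>. \<Sum>(shift_set i j \<F> F)) < (\<Sum>F\<in>\<F>. \<Sum>F)"
  proof (rule sum_strict_mono_ex1[OF assms(1) _ bexI[OF _ assms(4)], rotated])
    show "\<forall>F\<in>\<F>. \<Sum>(shift_set i j \<F> F) \<le> \<Sum>F"
      using sum_shift_set(1)[OF assms(2) assms(3)] by blast
  qed
  then show ?thesis
    unfolding weight_def shift_def by (simp add: sum.reindex[OF inj_on_shift_set])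
qed

text \<open>
  The first \<open>l\<close> elements of \<open>R\<close> (all of \<open>R\<close> if it has fewer), described by the rank so that \<open>R\<close> need not
  be enumerated.
\<close>

definition first :: "nat set \<Rightarrow> nat \<Rightarrow> nat set" where
  "first R l = {r \<in> R. card {x \<in> R. x < r} < l}"

lemma first_subset: "first R l \<subseteq> R" by (auto simp: first_def)

lemma first_mono: "l \<le> m \<Longrightarrow> first R l \<subseteq> first R m" by (auto simp: first_def)

lemma card_first:
  assumes "finite R"
  shows "card (first R l) = min l (card R)"
proof -
  let ?r = "\<lambda>r. card {x \<in> R. x < r}"
  have lt: "?r a < ?r b" if "a \<in> R" "a < b" for a b
    using that assms by (intro psubset_card_mono) auto
  have inj: "inj_on ?r R"
  proof (rule inj_onI)
    fix a b assume "a \<in> R" "b \<in> R" "?r a = ?r b"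
    then show "a = b" using lt[of a b] lt[of b a] by (cases a b rule: linorder_cases) simp_all
  qed
  have "?r ` R \<subseteq> {..<card R}"
    using assms by (auto intro!: psubset_card_mono)
  then have im: "?r ` R = {..<card R}"
    using card_image[OF inj] by (intro card_subset_eq) auto
  have "?r ` first R l = {..<l} \<inter> ?r ` R"
    by (auto simp: first_def)
  also have "\<dots> = {..<min l (card R)}"
    unfolding im by auto
  finally have "card (?r ` first R l) = min l (card R)" by simp
  then show ?thesis
    using card_image[OF inj_on_subset[OF inj first_subset]] by simp
qed

lemma card_first_diff:
  assumes "finite R"
  shows "card (first R (l + s) - first R l) \<le> s"
proof -
  have "card (first R (l + s) - first R l) = card (first R (l + s)) - card (first R l)"
    using finite_subset[OF first_subset assms] by (intro card_Diff_subset first_mono) auto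
  then show ?thesis using assms by (auto simp: card_first)
qed

lemma upto_eq_first:
  assumes "finite R"
  shows "{x \<in> R. x \<le> y} = first R (card {x \<in> R. x \<le> y})"
proof -
  have "card {x \<in> R. x < r} < card {x \<in> R. x \<le> y} \<longleftrightarrow> r \<le> y" if "r \<in> R" for r
  proof
    assume "r \<le> y"
    then show "card {x \<in> R. x < r} < card {x \<in> R. x \<le> y}"
      using assms that by (intro psubset_card_mono) auto
  next
    assume "card {x \<in> R. x < r} < card {x \<in> R. x \<le> y}"
    then have "\<not> {x \<in> R. x \<le> y} \<subseteq> {x \<in> R. x < r}"
      using assms card_mono[of "{x \<in> R. x < r}" "{x \<in> R. x \<le> y}"] by auto
    then show "r \<le> y" by auto
  qed
  then show ?thesis by (auto simp: first_def)
qed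

text \<open>
  If the two sets together never exceeded the size of an initial segment of \<open>R\<close>, there would always be
  room below a common point \<open>y\<close> of \<open>A\<close> and \<open>B\<close> to move \<open>y\<close> in \<open>A\<close> to a point that is free in both sets.
  Moving to the largest free point keeps all initial segments within their size, so that repetition
  leads to a member of \<open>\<A>\<close> that is disjoint from \<open>B\<close>.
\<close>

lemma shifted_cross_intersecting_prefix:
  assumes cross: "cross_intersecting \<A> \<B>" and sh: "shifted_on R \<A>" and fin: "finite R"
    and "A \<in> \<A>" "B \<in> \<B>" "A \<inter> B \<subseteq> R"
  shows "\<exists>l\<le>card R. l < card (A \<inter> first R l) + card (B \<inter> first R l)"
proof -
  let ?c = "\<lambda>S z. card {u \<in> R \<inter> S. u \<le> z}"
  have "\<exists>y. ?c UNIV y < ?c A y + ?c B y"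
    using \<open>A \<in> \<A>\<close> \<open>A \<inter> B \<subseteq> R\<close>
  proof (induction "card (A \<inter> B)" arbitrary: A rule: less_induct)
    case less
    show ?case
    proof (rule ccontr)
      assume "\<not> ?thesis"
      then have le: "?c A y + ?c B y \<le> ?c UNIV y" for y by (simp add: not_less)
      have "A \<inter> B \<noteq> {}"
        using cross less.prems \<open>B \<in> \<B>\<close> by (auto simp: cross_intersecting_def)
      then obtain y where y: "y \<in> A" "y \<in> B" "y \<in> R" using less.prems by blast
      have split: "?c S y = ?c S z + card {u \<in> R \<inter> S. z < u \<and> u \<le> y}" if "z \<le> y" for S z
      proof -
        have "{u \<in> R \<inter> S. u \<le> y} = {u \<in> R \<inter> S. u \<le> z} \<union> {u \<in> R \<inter> S. z < u \<and> u \<le> y}"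
          using that by auto
        then show ?thesis using fin by (simp add: card_Un_disjoint disjoint_iff)
      qed
      (* an interval of R that A and B cover, and that ends in the common point y, is counted too often *)
      have over: "card {u \<in> R \<inter> UNIV. P u \<and> u \<le> y} + 1
          \<le> card {u \<in> R \<inter> A. P u \<and> u \<le> y} + card {u \<in> R \<inter> B. P u \<and> u \<le> y}"
        if "P y" "\<And>u. u \<in> R \<Longrightarrow> P u \<Longrightarrow> u < y \<Longrightarrow> u \<in> A \<union> B" for P
      proof -
        let ?A = "{u \<in> R \<inter> A. P u \<and> u \<le> y}" and ?B = "{u \<in> R \<inter> B. P u \<and> u \<le> y}"
        have "{u \<in> R \<inter> UNIV. P u \<and> u \<le> y} \<subseteq> ?A \<union> ?B"
          using that y by (auto simp: le_less)
        then have "card {u \<in> R \<inter> UNIV. P u \<and> u \<le> y} \<le> card (?A \<union> ?B)"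
          using fin by (intro card_mono) auto
        moreover have "card {y} \<le> card (?A \<inter> ?B)"
          using fin y that by (intro card_mono) auto
        moreover have "card ?A + card ?B = card (?A \<union> ?B) + card (?A \<inter> ?B)"
          using fin by (intro card_Un_Int) auto
        ultimately show ?thesis by simp
      qed
      define Z where "Z = {x \<in> R. x < y \<and> x \<notin> A \<union> B}"
      have "Z \<noteq> {}"
      proof
        assume "Z = {}"
        then have "?c UNIV y + 1 \<le> ?c A y + ?c B y"
          using over[of "\<lambda>_. True"] by (auto simp: Z_def)
        then show False using le[of y] by simp
      qed
      define x where "x = Max Z"
      have "finite Z" using fin by (simp add: Z_def)
      with \<open>Z \<noteq> {}\<close> have "x \<in> Z" unfolding x_def by (rule Max_in[rotated])
      then have x: "x \<in> R" "x < y" "x \<notin> A" "x \<notin> B" by (auto simp: Z_def)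
      have above: "u \<in> A \<union> B" if "u \<in> R" "x < u" "u < y" for u
      proof -
        have "u \<notin> Z" using that Max_ge[OF \<open>finite Z\<close>, of u] unfolding x_def by auto
        then show ?thesis using that by (auto simp: Z_def)
      qed
      let ?A' = "insert x (A - {y})"
      have A': "?A' \<in> \<A>"
        using sh less.prems x y by (auto simp: shifted_on_def)
      have int: "?A' \<inter> B = A \<inter> B - {y}" using x by auto
      have finI: "finite (A \<inter> B)" using less.prems fin finite_subset by blast
      have "card (?A' \<inter> B) < card (A \<inter> B)"
        unfolding int using y finI by (intro card_Diff1_less) auto
      then obtain z where z: "?c UNIV z < ?c ?A' z + ?c B z"
        using less.hyps[of ?A'] A' less.prems int by auto
      have eq: "{u \<in> R \<inter> ?A'. u \<le> z} =
          (if x \<le> z then {x} else {}) \<union> ({u \<in> R \<inter> A. u \<le> z} - {y})"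
        using x by auto
      consider "z < x" | "x \<le> z" "z < y" | "y \<le> z" by linarith
      then show False
      proof cases
        case 1
        then have "{u \<in> R \<inter> ?A'. u \<le> z} = {u \<in> R \<inter> A. u \<le> z}" using eq x by auto
        then show ?thesis using z le[of z] by simp
      next
        case 2
        have "{u \<in> R \<inter> ?A'. u \<le> z} = insert x {u \<in> R \<inter> A. u \<le> z}" using eq 2 by auto
        then have "?c ?A' z = ?c A z + 1" using x fin by simp
        moreover have "card {u \<in> R \<inter> UNIV. z < u \<and> u \<le> y} + 1
          \<le> card {u \<in> R \<inter> A. z < u \<and> u \<le> y} + card {u \<in> R \<inter> B. z < u \<and> u \<le> y}"
          using 2 above by (intro over) auto
        ultimately show ?thesis
          using z le[of y] split[of z UNIV] split[of z A] split[of z B] 2 by linarith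
      next
        case 3
        have "{u \<in> R \<inter> ?A'. u \<le> z} = insert x ({u \<in> R \<inter> A. u \<le> z} - {y})" using eq 3 x by auto
        moreover have "card (insert x ({u \<in> R \<inter> A. u \<le> z} - {y})) = Suc (card ({u \<in> R \<inter> A. u \<le> z} - {y}))"
          using x fin by (intro card_insert_disjoint) auto
        moreover have "Suc (card ({u \<in> R \<inter> A. u \<le> z} - {y})) = ?c A z"
          using y 3 fin by (intro card_Suc_Diff1) auto
        ultimately have "?c ?A' z = ?c A z" by (simp only:)
        then show ?thesis using z le[of z] by simp
      qed
    qed
  qed
  then obtain y where y: "?c UNIV y < ?c A y + ?c B y" ..
  define l where "l = card {u \<in> R. u \<le> y}"
  have "{u \<in> R \<inter> S. u \<le> y} = S \<inter> first R l" for S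
    using upto_eq_first[OF fin, of y] unfolding l_def by auto
  moreover have "l \<le> card R" unfolding l_def using fin by (intro card_mono) auto
  ultimately show ?thesis using y l_def by auto
qed

section \<open>Counting sets that are dense on windows\<close>

lemma card_nsets_superset_le:
  assumes "finite V"
  shows "card {F \<in> nsets V k. Z \<subseteq> F} \<le> (card V - card Z) choose (k - card Z)"
proof (cases "Z \<subseteq> V")
  case True
  have fZ: "finite Z" using True assms finite_subset by blast
  have inj: "inj_on (\<lambda>F. F - Z) {F \<in> nsets V k. Z \<subseteq> F}"
    by (rule inj_onI) blast
  have "(\<lambda>F. F - Z) ` {F \<in> nsets V k. Z \<subseteq> F} \<subseteq> nsets (V - Z) (k - card Z)"
    using fZ by (auto simp: nsets_def card_Diff_subset)
  then have "card {F \<in> nsets V k. Z \<subseteq> F} \<le> card (nsets (V - Z) (k - card Z))"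
    using assms by (intro card_inj_on_le[OF inj] finite_imp_finite_nsets) auto
  then show ?thesis using assms True fZ by (simp add: card_Diff_subset)
next
  case False
  then have "{F \<in> nsets V k. Z \<subseteq> F} = {}" by (auto simp: nsets_def)
  then show ?thesis by (simp only: card.empty)
qed

lemma card_nsets_two_windows_le:
  assumes fin: "finite V" and sub: "U \<subseteq> V" "W \<subseteq> V" and disj: "U \<inter> W = {}"
  shows "card {F \<in> nsets V k. u \<le> card (F \<inter> U) \<and> w \<le> card (F \<inter> W)}
    \<le> (card U choose u) * (card W choose w) * ((card V - (u + w)) choose (k - (u + w)))"
    (is "card ?L \<le> _")
proof -
  have fUW: "finite U" "finite W" using fin sub finite_subset by auto
  let ?I = "nsets U u \<times> nsets W w"
  let ?G = "\<lambda>(A, B). {F \<in> nsets V k. A \<union> B \<subseteq> F}"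
  have "?L \<subseteq> (\<Union>p\<in>?I. ?G p)"
  proof
    fix F assume F: "F \<in> ?L"
    obtain A where "A \<subseteq> F \<inter> U" "card A = u" "finite A"
      using F obtain_subset_with_card_n[of u "F \<inter> U"] by blast
    moreover obtain B where "B \<subseteq> F \<inter> W" "card B = w" "finite B"
      using F obtain_subset_with_card_n[of w "F \<inter> W"] by blast
    ultimately have "(A, B) \<in> ?I" "F \<in> ?G (A, B)"
      using F by (auto simp: nsets_def)
    then show "F \<in> (\<Union>p\<in>?I. ?G p)" by blast
  qed
  moreover have finI: "finite ?I" using fUW by (simp add: finite_imp_finite_nsets)
  moreover have "finite (?G p)" for p using fin by (auto simp: finite_imp_finite_nsets split: prod.split)
  ultimately have "card ?L \<le> card (\<Union>p\<in>?I. ?G p)" by (intro card_mono) auto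
  also have "\<dots> \<le> (\<Sum>p\<in>?I. card (?G p))" by (rule card_UN_le[OF finI])
  also have "\<dots> \<le> (\<Sum>p\<in>?I. (card V - (u + w)) choose (k - (u + w)))"
  proof (rule sum_mono)
    fix p assume "p \<in> ?I"
    then obtain A B where p: "p = (A, B)" "A \<subseteq> U" "B \<subseteq> W" "card A = u" "card B = w" "finite A" "finite B"
      by (auto simp: nsets_def)
    then have "card (A \<union> B) = u + w" using disj by (subst card_Un_disjoint) auto
    then show "card (?G p) \<le> (card V - (u + w)) choose (k - (u + w))"
      using card_nsets_superset_le[OF fin, of k "A \<union> B"] p(1) by simp
  qed
  finally show ?thesis using fUW by (simp add: card_cartesian_product)
qed

lemma card_nsets_window_le:
  assumes "finite V" "U \<subseteq> V"
  shows "card {F \<in> nsets V k. u \<le> card (F \<inter> U)} \<le> (card U choose u) * ((card V - u) choose (k - u))"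
  using card_nsets_two_windows_le[OF assms, of "{}" k u 0] by simp

lemma binomial_link_decay:
  fixes w :: nat
  assumes "w * a \<le> v" "0 < a"
  shows "w * ((v - 1) choose (a - 1)) \<le> v choose a"
proof -
  have "a * (w * ((v - 1) choose (a - 1))) \<le> v * ((v - 1) choose (a - 1))"
    using assms(1) by (metis mult.assoc mult.commute mult_le_mono1)
  also have "\<dots> = a * (v choose a)" using times_binomial_minus1_eq[OF assms(2)] by simp
  finally show ?thesis using assms(2) by simp
qed

text \<open>
  Prescribing one more point leaves at most the fraction \<open>k / n \<le> 1 / w\<close> of the \<open>k\<close>-sets, because
  \<open>(k - i) / (n - i) \<le> k / n\<close>.
\<close>

lemma binomial_link_decay_power:
  fixes w :: nat
  assumes "w * k \<le> n" "0 < w" "b + j \<le> k"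
  shows "w ^ j * ((n - (b + j)) choose (k - (b + j))) \<le> (n - b) choose (k - b)"
  using assms(3)
proof (induction j)
  case (Suc j)
  have "w * (k - (b + j)) \<le> n - (b + j)"
  proof -
    have "w * (k - (b + j)) = w * k - w * (b + j)" by (rule diff_mult_distrib2)
    also have "\<dots> \<le> w * k - (b + j)" using assms(2) by (intro diff_le_mono2) simp
    also have "\<dots> \<le> n - (b + j)" using assms(1) by (rule diff_le_mono)
    finally show ?thesis .
  qed
  then have "w * ((n - (b + j) - 1) choose (k - (b + j) - 1)) \<le> (n - (b + j)) choose (k - (b + j))"
    using Suc.prems assms(2) by (intro binomial_link_decay) auto
  then have "w ^ j * (w * ((n - (b + j) - 1) choose (k - (b + j) - 1)))
      \<le> w ^ j * ((n - (b + j)) choose (k - (b + j)))" by (rule mult_le_mono2)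
  also have "\<dots> \<le> (n - b) choose (k - b)" using Suc by simp
  finally show ?case by (simp add: ac_simps)
qed simp

text \<open>
  From \<open>j\<close> to \<open>j + 1\<close> the binomial coefficient next to the central one grows by the factor
  \<open>(2j + 2)(2j + 1) / (j(j + 2))\<close>, which is at most \<open>4\<close>. The bound \<open>4 ^ j\<close> would be too weak for
  \<open>d = 2\<close> later on.
\<close>

lemma central_binomial_upper:
  assumes "1 \<le> j" "1 \<le> i"
  shows "(2 * j) choose (j + i) \<le> 4 ^ (j - 1)"
proof -
  have "(2 * j) choose (j + 1) \<le> 4 ^ (j - 1)" using assms(1)
  proof (induction j rule: dec_induct)
    case (step j)
    have e1: "(j + 2) * ((2 * j + 2) choose (j + 2)) = (2 * j + 2) * ((2 * j + 1) choose (j + 1))"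
      using times_binomial_minus1_eq[of "j + 2" "2 * j + 2"] by simp
    have "(2 * j + 1) choose (j + 1) = (2 * j + 1) choose j"
      using binomial_symmetric[of "j + 1" "2 * j + 1"] by simp
    moreover have "(2 * j + 1 - j) * ((2 * j + 1) choose j) = (2 * j + 1) * ((2 * j) choose j)"
      using binomial_absorb_comp[of "2 * j + 1" j] by simp
    ultimately have e2: "(j + 1) * ((2 * j + 1) choose (j + 1)) = (2 * j + 1) * ((2 * j) choose j)"
      by simp
    have e3: "(j + 1) * ((2 * j) choose (j + 1)) = j * ((2 * j) choose j)"
    proof -
      have "(j + 1) * ((2 * j) choose (j + 1)) = (2 * j) * ((2 * j - 1) choose j)"
        using times_binomial_minus1_eq[of "j + 1" "2 * j"] by simp
      also have "\<dots> = j * ((2 * j) choose j)"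
        using binomial_absorb_comp[of "2 * j" j] by auto
      finally show ?thesis .
    qed
    let ?x = "(2 * j + 2) choose (j + 2)" and ?y = "(2 * j) choose (j + 1)"
    let ?a = "(2 * j + 1) choose (j + 1)" and ?b = "(2 * j) choose j"
    have "(j * (j + 2)) * ?x = j * ((2 * j + 2) * ?a)"
      unfolding e1[symmetric] by (rule mult.assoc)
    also have "\<dots> = j * 2 * ((j + 1) * ?a)"
    proof -
      have "(2 * j + 2) = 2 * (j + 1)" by simp
      then show ?thesis by (simp only: mult.assoc)
    qed
    also have "\<dots> = 2 * (2 * j + 1) * (j * ?b)"
      unfolding e2 by (simp only: ac_simps)
    also have "\<dots> = (2 * (2 * j + 1) * (j + 1)) * ?y"
      unfolding e3[symmetric] by (simp only: mult.assoc)
    also have "\<dots> \<le> (4 * (j * (j + 2))) * ?y"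
      using step.hyps by (intro mult_le_mono1) (simp add: algebra_simps)
    finally have "(j * (j + 2)) * ?x \<le> (j * (j + 2)) * (4 * ?y)" by (simp only: mult.assoc mult.left_commute)
    then have "?x \<le> 4 * ?y" using step.hyps by simp
    also have "\<dots> \<le> 4 * 4 ^ (j - 1)" using step.IH by simp
    also have "\<dots> = 4 ^ (Suc j - 1)" using step.hyps by (cases j) auto
    finally show ?case by simp
  qed (simp add: numeral_2_eq_2)
  moreover have "(2 * j) choose (j + i) \<le> (2 * j) choose (j + 1)"
  proof (cases "j + i \<le> 2 * j")
    case True then show ?thesis using assms by (intro binomial_antimono) auto
  qed (simp add: binomial_eq_0)
  ultimately show ?thesis by simp
qed

text \<open>
  From \<open>j\<close> to \<open>j + 1\<close> the coefficient grows by \<open>(d + 2j + 1)(d + 2j) / (j(d + j + 1))\<close>, which is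
  largest at \<open>j = 1\<close>, where it equals \<open>d + 3\<close>.
\<close>

lemma near_full_binomial_upper:
  assumes "2 \<le> d" "1 \<le> j"
  shows "(d + 2 * j - 1) choose (d + j) \<le> (d + 3) ^ (j - 1)"
  using assms(2)
proof (induction j rule: dec_induct)
  case base show ?case by simp
next
  case (step j)
  let ?x = "(d + 2 * j + 1) choose (d + j + 1)" and ?a = "(d + 2 * j) choose (d + j)"
    and ?y = "(d + 2 * j - 1) choose (d + j)"
  have e1: "(d + j + 1) * ?x = (d + 2 * j + 1) * ?a"
    using times_binomial_minus1_eq[of "d + j + 1" "d + 2 * j + 1"] by simp
  have e2: "j * ?a = (d + 2 * j) * ?y"
    using binomial_absorb_comp[of "d + 2 * j" "d + j"] by simp
  have "(j * (d + j + 1)) * ?x = j * ((d + 2 * j + 1) * ?a)"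
    unfolding e1[symmetric] by (rule mult.assoc)
  also have "\<dots> = (d + 2 * j + 1) * (j * ?a)" by (rule mult.left_commute)
  also have "\<dots> = ((d + 2 * j + 1) * (d + 2 * j)) * ?y"
    unfolding e2 by (simp only: mult.assoc)
  also have "\<dots> \<le> ((d + 3) * (j * (d + j + 1))) * ?y"
  proof (rule mult_le_mono1)
    obtain e where "d = e + 2" using assms(1) by (metis add.commute le_Suc_ex)
    moreover obtain i where "j = i + 1" using step.hyps by (metis add.commute le_Suc_ex)
    ultimately show "(d + 2 * j + 1) * (d + 2 * j) \<le> (d + 3) * (j * (d + j + 1))"
      by (simp add: algebra_simps)
  qed
  finally have "(j * (d + j + 1)) * ?x \<le> (j * (d + j + 1)) * ((d + 3) * ?y)"
    by (simp only: mult.assoc mult.left_commute)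
  then have "?x \<le> (d + 3) * ?y" using step.hyps by simp
  also have "\<dots> \<le> (d + 3) * (d + 3) ^ (j - 1)" using step.IH by simp
  also have "\<dots> = (d + 3) ^ (Suc j - 1)" using step.hyps by (cases j) auto
  finally show ?case by simp
qed

lemma sum_power_tail_le:
  fixes r :: real
  assumes "0 \<le> r" "r < 1" "1 \<le> i"
  shows "(\<Sum>j=i..m. r ^ (j - 1)) \<le> r ^ (i - 1) / (1 - r)"
proof -
  have "(1 - r) * (\<Sum>j=i..m. r ^ (j - 1)) \<le> r ^ (i - 1)"
  proof (cases "i \<le> m")
    case True
    have "(\<Sum>j=i..m. r ^ (j - 1)) = (\<Sum>j=i-1..m-1. r ^ j)"
      using assms(3) True by (intro sum.reindex_bij_witness[of _ Suc "\<lambda>j. j - 1"]) auto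
    then have "(1 - r) * (\<Sum>j=i..m. r ^ (j - 1)) = r ^ (i - 1) - r ^ Suc (m - 1)"
      using True by (simp only: sum_gp_multiplied[of "i - 1" "m - 1"] diff_le_mono)
    then show ?thesis using assms by simp
  qed (use assms in simp)
  then show ?thesis using assms by (simp add: field_simps)
qed

section \<open>Degrees\<close>

definition deg :: "'a set set \<Rightarrow> 'a \<Rightarrow> nat" where
  "deg \<F> x = card {F \<in> \<F>. x \<in> F}"

lemma sum_deg_eq_sum_card_inter:
  assumes "finite \<F>" "finite S"
  shows "(\<Sum>x\<in>S. deg \<F> x) = (\<Sum>F\<in>\<F>. card (F \<inter> S))"
proof -
  have "(\<Sum>x\<in>S. deg \<F> x) = (\<Sum>x\<in>S. \<Sum>F\<in>\<F>. if x \<in> F then 1 else 0)"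
    using assms by (simp add: deg_def sum.If_cases Int_def)
  also have "\<dots> = (\<Sum>F\<in>\<F>. \<Sum>x\<in>S. if x \<in> F then 1 else 0)" by (rule sum.swap)
  also have "\<dots> = (\<Sum>F\<in>\<F>. card (F \<inter> S))"
    using assms by (simp add: sum.If_cases Int_def conj_commute)
  finally show ?thesis .
qed

text \<open>
  Shifting inside \<open>V - S\<close> leaves the traces on \<open>S\<close> alone. A pair of families of least total weight is
  shifted there.
\<close>

lemma ex_shifted_cross_intersecting:
  assumes V: "finite V" and AB: "\<A> \<subseteq> nsets V k" "\<B> \<subseteq> nsets V k" "cross_intersecting \<A> \<B>"
    and S: "\<forall>A\<in>\<A>. S \<subseteq> A" "\<forall>B\<in>\<B>. B \<inter> S = {}"
  obtains \<A>' \<B>' where "\<A>' \<subseteq> nsets V k" "\<B>' \<subseteq> nsets V k" "cross_intersecting \<A>' \<B>'"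
    "\<forall>A\<in>\<A>'. S \<subseteq> A" "\<forall>B\<in>\<B>'. B \<inter> S = {}" "card \<A>' = card \<A>" "card \<B>' = card \<B>"
    "shifted_on (V - S) \<A>'"
proof -
  define P where "P = (\<lambda>(\<A>', \<B>'). \<A>' \<subseteq> nsets V k \<and> \<B>' \<subseteq> nsets V k \<and> cross_intersecting \<A>' \<B>' \<and>
    (\<forall>A\<in>\<A>'. S \<subseteq> A) \<and> (\<forall>B\<in>\<B>'. B \<inter> S = {}) \<and> card \<A>' = card \<A> \<and> card \<B>' = card \<B>)"
  have "P (\<A>, \<B>)" using AB S by (simp add: P_def)
  then obtain p where p: "P p" "\<And>q. P q \<Longrightarrow> weight (fst p) + weight (snd p) \<le> weight (fst q) + weight (snd q)"
    using ex_has_least_nat[of P "(\<A>, \<B>)" "\<lambda>p. weight (fst p) + weight (snd p)"] by blast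
  obtain \<A>' \<B>' where p_eq: "p = (\<A>', \<B>')" by force
  have P: "\<A>' \<subseteq> nsets V k" "\<B>' \<subseteq> nsets V k" "cross_intersecting \<A>' \<B>'"
    "\<forall>A\<in>\<A>'. S \<subseteq> A" "\<forall>B\<in>\<B>'. B \<inter> S = {}" "card \<A>' = card \<A>" "card \<B>' = card \<B>"
    using p(1) by (auto simp: P_def p_eq)
  have fin: "finite \<A>'" "finite \<B>'" "\<And>F. F \<in> \<A>' \<Longrightarrow> finite F" "\<And>F. F \<in> \<B>' \<Longrightarrow> finite F"
    using P(1,2) finite_subset[OF _ finite_imp_finite_nsets[OF V]] by (blast, blast, auto simp: nsets_def)
  have "insert i (F - {j}) \<in> \<A>'"
    if F: "F \<in> \<A>'" and ij: "i \<in> V - S" "j \<in> V - S" "i < j" "j \<in> F" "i \<notin> F" for F i j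
  proof (rule ccontr)
    assume "insert i (F - {j}) \<notin> \<A>'"
    then have "weight (shift i j \<A>') < weight \<A>'" using F ij fin by (intro weight_shift_less) auto
    moreover have "weight (shift i j \<B>') \<le> weight \<B>'" using fin ij by (intro weight_shift_le) auto
    moreover have "P (shift i j \<A>', shift i j \<B>')"
    proof -
      have tr: "x \<in> shift_set i j \<F> F \<longleftrightarrow> x \<in> F" if "x \<in> S" for x \<F> F
        using that ij by (intro mem_shift_set_other) auto
      have "\<forall>A\<in>shift i j \<A>'. S \<subseteq> A" using P(4) by (simp add: shift_def subset_iff tr)
      have disj: "B \<inter> S = {} \<longleftrightarrow> (\<forall>x\<in>S. x \<notin> B)" for B by blast
      have "\<forall>B\<in>shift i j \<B>'. B \<inter> S = {}" using P(5) by (simp add: shift_def disj tr)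
      with \<open>\<forall>A\<in>shift i j \<A>'. S \<subseteq> A\<close> show ?thesis
        using P ij by (simp add: P_def card_shift shift_subset_nsets cross_intersecting_shift)
    qed
    ultimately show False
      using p(2)[of "(shift i j \<A>', shift i j \<B>')"] by (simp add: p_eq)
  qed
  then have "shifted_on (V - S) \<A>'" unfolding shifted_on_def by blast
  then show thesis using that P by blast
qed

lemma intersecting_iff_cross: "intersecting \<F> \<longleftrightarrow> cross_intersecting \<F> \<F>"
  by (simp add: intersecting_def cross_intersecting_def)

lemma deg_shift_eq: "deg (shift i j \<F>) x = card {F \<in> \<F>. x \<in> shift_set i j \<F> F}"
proof -
  have "{F \<in> shift i j \<F>. x \<in> F} = shift_set i j \<F> ` {F \<in> \<F>. x \<in> shift_set i j \<F> F}"
    by (auto simp: shift_def)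
  then show ?thesis
    unfolding deg_def by (simp add: card_image inj_on_subset[OF inj_on_shift_set])
qed

lemma deg_shift_other: "x \<noteq> i \<Longrightarrow> x \<noteq> j \<Longrightarrow> deg (shift i j \<F>) x = deg \<F> x"
  unfolding deg_shift_eq unfolding deg_def by (simp add: mem_shift_set_other)

lemma deg_shift_le:
  assumes "finite \<F>" "x \<noteq> i"
  shows "deg (shift i j \<F>) x \<le> deg \<F> x"
  unfolding deg_shift_eq unfolding deg_def
  using assms by (intro card_mono) (auto simp: shift_set_def split: if_splits)

lemma deg_shift_target_le:
  assumes "finite \<F>"
  shows "deg (shift i j \<F>) i \<le> deg \<F> i + deg \<F> j"
proof -
  have "deg (shift i j \<F>) i \<le> card ({F \<in> \<F>. i \<in> F} \<union> {F \<in> \<F>. j \<in> F})"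
    unfolding deg_shift_eq
    using assms by (intro card_mono) (auto simp: shift_set_def split: if_splits)
  also have "\<dots> \<le> deg \<F> i + deg \<F> j" unfolding deg_def by (rule card_Un_le)
  finally show ?thesis .
qed

lemma sum_choose_card_inter:
  assumes "finite \<F>" "finite Y"
  shows "(\<Sum>F\<in>\<F>. card (F \<inter> Y) choose d) = (\<Sum>S\<in>nsets Y d. card {F \<in> \<F>. S \<subseteq> F})"
proof -
  have fin: "finite (nsets Y d)" using assms by (simp add: finite_imp_finite_nsets)
  have "card (F \<inter> Y) choose d = (\<Sum>S\<in>nsets Y d. if S \<subseteq> F then 1 else 0)" for F
  proof -
    have "nsets (F \<inter> Y) d = {S \<in> nsets Y d. S \<subseteq> F}" by (auto simp: nsets_def)
    then have "card (F \<inter> Y) choose d = card {S \<in> nsets Y d. S \<subseteq> F}"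
      using card_nsets[of "F \<inter> Y" d] by simp
    then show ?thesis using fin by (simp add: sum.If_cases Int_def)
  qed
  then have "(\<Sum>F\<in>\<F>. card (F \<inter> Y) choose d) = (\<Sum>F\<in>\<F>. \<Sum>S\<in>nsets Y d. if S \<subseteq> F then 1 else 0)"
    by simp
  also have "\<dots> = (\<Sum>S\<in>nsets Y d. \<Sum>F\<in>\<F>. if S \<subseteq> F then 1 else 0)" by (rule sum.swap)
  also have "\<dots> = (\<Sum>S\<in>nsets Y d. card {F \<in> \<F>. S \<subseteq> F})"
    using assms by (simp add: sum.If_cases Int_def)
  finally show ?thesis .
qed

text \<open>
  The linear lower bound for \<open>z choose d\<close> that turns an average above \<open>d - 1\<close> into many \<open>d\<close>-subsets.
\<close>

lemma le_pred_plus_choose: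
  assumes "1 \<le> d"
  shows "z \<le> (d - 1) + (z choose d)"
proof (induction z)
  case (Suc z)
  show ?case
  proof (cases "d \<le> Suc z")
    case True
    obtain e where e: "d = Suc e" using assms by (cases d) auto
    have "0 < z choose e" using True e by (intro zero_less_binomial) simp
    then show ?thesis using Suc.IH by (simp add: e del: zero_less_binomial_iff)
  qed simp
qed simp

section \<open>Sets concentrated on few points are rare\<close>

locale large_ground_set =
  fixes n k d :: nat
  assumes d_less_k: "d < k" and d_ge_2: "2 \<le> d" and n_large: "4 * (d - 1) * d * k \<le> n"
begin

text \<open>
  The number of \<open>k\<close>-sets that contain \<open>d + 1\<close> given points; all counts below are multiples of it.
\<close>

definition N :: nat where "N = (n - d - 1) choose (k - d - 1)"

definition w :: nat where "w = 4 * (d - 1) * d"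

lemma w_ge: "8 \<le> w" "8 * (d + 3) \<le> 5 * w"
proof -
  obtain e where e: "d = e + 2" using d_ge_2 by (metis add.commute le_Suc_ex)
  show "8 \<le> w" "8 * (d + 3) \<le> 5 * w" unfolding w_def unfolding e by (simp_all add: algebra_simps)
qed

lemma w_k_le_n: "w * k \<le> n"
  using n_large by (simp only: w_def)

lemma k_le_n: "k \<le> n"
proof -
  have "1 * k \<le> w * k" using w_ge(1) by (intro mult_le_mono1) simp
  from le_trans[OF this w_k_le_n] show ?thesis by simp
qed

lemma N_pos: "0 < N"
  unfolding N_def using k_le_n by (simp add: zero_less_binomial_iff)

lemma choose_le_N:
  assumes "1 \<le> j" "d + j \<le> k"
  shows "real ((n - (d + j)) choose (k - (d + j))) \<le> (1 / w) ^ (j - 1) * N"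
proof -
  have "w ^ (j - 1) * ((n - (d + 1 + (j - 1))) choose (k - (d + 1 + (j - 1)))) \<le> (n - (d + 1)) choose (k - (d + 1))"
  proof (rule binomial_link_decay_power)
    show "w * k \<le> n" by (rule w_k_le_n)
  qed (use assms w_ge(1) in auto)
  then have "w ^ (j - 1) * ((n - (d + j)) choose (k - (d + j))) \<le> N"
    using assms by (simp add: N_def)
  then have "real (w ^ (j - 1) * ((n - (d + j)) choose (k - (d + j)))) \<le> N" by (rule of_nat_mono)
  then show ?thesis using w_ge(1) by (simp add: field_simps)
qed

text \<open>
  The windows \<open>W s\<close> stand for the \<open>s\<close> points that follow \<open>Y\<close>. A set that has \<open>d - i\<close> points in \<open>Y\<close> and
  \<open>j + i\<close> in \<open>W (2 * j)\<close> is pinned down in \<open>d + j\<close> points, so that \<open>j \<ge> 1\<close> makes the count a multiple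
  of \<open>N\<close>. As \<open>j + i\<close> points fit into the window only if \<open>j \<ge> i\<close>, the contributions decay in \<open>i\<close> as well.
  Sets with at least \<open>d\<close> points in \<open>Y\<close> are absorbed by the case \<open>i = 1\<close>.
\<close>

lemma card_dense_le:
  assumes Y: "Y \<subseteq> {1..n}" "card Y \<le> 2 * d\<^sup>2"
    and W: "\<And>s. W s \<subseteq> {1..n} - Y" "\<And>s. card (W s) \<le> s"
  shows "card {F \<in> nsets {1..n} k. \<exists>j\<ge>1. j + max 1 (d - card (F \<inter> Y)) \<le> card (F \<inter> W (2 * j))}
    \<le> 4 * ((2 * d\<^sup>2) choose (d - 1)) * N" (is "card ?D \<le> _")
proof -
  define G where "G = (\<lambda>i j. {F \<in> nsets {1..n} k. d - i \<le> card (F \<inter> Y) \<and> j + i \<le> card (F \<inter> W (2 * j))})"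
  define C where "C = (2 * d\<^sup>2) choose (d - 1)"
  have finG: "finite (G i j)" for i j by (simp add: G_def finite_imp_finite_nsets)
  have "?D \<subseteq> (\<Union>i\<in>{1..d}. \<Union>j\<in>{i..k - d}. G i j)"
  proof
    fix F assume "F \<in> ?D"
    then obtain j where F: "F \<in> nsets {1..n} k" and j: "1 \<le> j" "j + max 1 (d - card (F \<inter> Y)) \<le> card (F \<inter> W (2 * j))"
      by blast
    define i where "i = max 1 (d - card (F \<inter> Y))"
    have finF: "finite F" "card F = k" using F by (auto simp: nsets_def)
    have i: "1 \<le> i" "i \<le> d" "d - i \<le> card (F \<inter> Y)" using d_ge_2 by (auto simp: i_def)
    have "finite (W (2 * j))" using W finite_subset by blast
    then have "card (F \<inter> W (2 * j)) \<le> card (W (2 * j))" by (intro card_mono) auto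
    then have "i \<le> j" using j W(2)[of "2 * j"] by (simp add: i_def)
    have "card (F \<inter> Y) + card (F \<inter> W (2 * j)) = card (F \<inter> Y \<union> F \<inter> W (2 * j))"
      using finF W by (intro card_Un_disjoint[symmetric]) auto
    also have "\<dots> \<le> card F" using finF by (intro card_mono) auto
    finally have "j \<le> k - d" using i j finF by (simp add: i_def)
    have "F \<in> G i j" using F i j by (simp add: G_def i_def)
    with i \<open>i \<le> j\<close> \<open>j \<le> k - d\<close> show "F \<in> (\<Union>i\<in>{1..d}. \<Union>j\<in>{i..k - d}. G i j)"
      by (intro UN_I[of i] UN_I[of j]) auto
  qed
  then have "card ?D \<le> card (\<Union>i\<in>{1..d}. \<Union>j\<in>{i..k - d}. G i j)"
    using finG by (intro card_mono) auto
  also have "\<dots> \<le> (\<Sum>i=1..d. card (\<Union>j\<in>{i..k - d}. G i j))" by (rule card_UN_le) simp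
  also have "\<dots> \<le> (\<Sum>i=1..d. \<Sum>j=i..k-d. card (G i j))" by (intro sum_mono card_UN_le) simp
  finally have "real (card ?D) \<le> (\<Sum>i=1..d. \<Sum>j=i..k-d. real (card (G i j)))"
    by (simp flip: of_nat_sum)
  also have "\<dots> \<le> (\<Sum>i=1..d. \<Sum>j=i..k-d. C * N * (1/2) ^ (j - 1))"
  proof (intro sum_mono)
    fix i j assume ij: "i \<in> {1..d}" "j \<in> {i..k - d}"
    have "card (G i j) \<le> (card Y choose (d - i)) * (card (W (2 * j)) choose (j + i))
        * ((card {1..n} - (d - i + (j + i))) choose (k - (d - i + (j + i))))"
      unfolding G_def using Y W by (intro card_nsets_two_windows_le) auto
    also have "\<dots> = (card Y choose (d - i)) * (card (W (2 * j)) choose (j + i)) * ((n - (d + j)) choose (k - (d + j)))"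
      using ij by simp
    also have "\<dots> \<le> C * 4 ^ (j - 1) * ((n - (d + j)) choose (k - (d + j)))"
    proof (intro mult_le_mono order.refl)
      have "2 * (d - 1) \<le> 2 * d\<^sup>2" using le_square[of d] unfolding power2_eq_square by linarith
      then show "card Y choose (d - i) \<le> C"
        unfolding C_def using ij Y(2) by (intro le_trans[OF binomial_right_mono binomial_mono]) auto
      show "card (W (2 * j)) choose (j + i) \<le> 4 ^ (j - 1)"
        using ij W(2)[of "2 * j"] by (intro le_trans[OF binomial_right_mono central_binomial_upper]) auto
    qed
    finally have "real (card (G i j)) \<le> real (C * 4 ^ (j - 1)) * real ((n - (d + j)) choose (k - (d + j)))"
      unfolding of_nat_mult[symmetric] by (rule of_nat_mono)
    also have "\<dots> \<le> real (C * 4 ^ (j - 1)) * ((1 / w) ^ (j - 1) * N)"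
      using ij d_less_k by (intro mult_left_mono choose_le_N) auto
    also have "\<dots> = C * N * (4 / w) ^ (j - 1)" by (simp add: power_divide)
    also have "\<dots> \<le> C * N * (1/2) ^ (j - 1)"
      using w_ge(1) by (intro mult_left_mono power_mono) (auto simp: field_simps)
    finally show "real (card (G i j)) \<le> C * N * (1/2) ^ (j - 1)" .
  qed
  also have "\<dots> = C * N * (\<Sum>i=1..d. \<Sum>j=i..k-d. (1/2) ^ (j - 1))"
    by (simp add: sum_distrib_left)
  also have "\<dots> \<le> C * N * (\<Sum>i=1..d. 2 * (1/2) ^ (i - 1))"
  proof (intro mult_left_mono sum_mono)
    fix i assume "i \<in> {1..d}"
    then show "(\<Sum>j=i..k-d. (1/2) ^ (j - 1)) \<le> 2 * (1/2 :: real) ^ (i - 1)"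
      using sum_power_tail_le[of "1/2" i "k - d"] by simp
  qed simp
  also have "\<dots> \<le> real (C * N) * 4"
  proof (rule mult_left_mono)
    show "(\<Sum>i=1..d. 2 * (1/2) ^ (i - 1)) \<le> (4 :: real)"
      using sum_power_tail_le[of "1/2" 1 d] by (simp flip: sum_distrib_left)
  qed simp
  finally have "real (card ?D) \<le> real (4 * C * N)" by simp
  then show ?thesis by (simp only: of_nat_le_iff C_def)
qed

text \<open>
  A set over \<open>S\<close> with \<open>j + 1\<close> further prescribed points has \<open>d + j + 1\<close> prescribed points altogether, one
  more than in the preceding lemma; this gains the factor \<open>1 / 8\<close>.
\<close>

lemma card_dense_over_le:
  assumes S: "S \<subseteq> {1..n}" "card S = d"
    and W: "\<And>s. W s \<subseteq> {1..n} - S" "\<And>s. card (W s) \<le> s"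
  shows "4 * card {F \<in> nsets {1..n} k. S \<subseteq> F \<and> (\<exists>j\<ge>1. j + 1 \<le> card (F \<inter> W (2 * j)))} \<le> N"
    (is "4 * card ?D \<le> _")
proof -
  define G where "G = (\<lambda>j. {F \<in> nsets {1..n} k. d \<le> card (F \<inter> S) \<and> j + 1 \<le> card (F \<inter> W (2 * j))})"
  have finG: "finite (G j)" for j by (simp add: G_def finite_imp_finite_nsets)
  have "?D \<subseteq> (\<Union>j\<in>{1..k - d - 1}. G j)"
  proof
    fix F assume "F \<in> ?D"
    then obtain j where F: "F \<in> nsets {1..n} k" "S \<subseteq> F" and j: "1 \<le> j" "j + 1 \<le> card (F \<inter> W (2 * j))"
      by blast
    have finF: "finite F" "card F = k" using F by (auto simp: nsets_def)
    have FS: "F \<inter> S = S" using F by blast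
    have "card (F \<inter> S) + card (F \<inter> W (2 * j)) = card (F \<inter> S \<union> F \<inter> W (2 * j))"
      using finF W by (intro card_Un_disjoint[symmetric]) auto
    also have "\<dots> \<le> card F" using finF by (intro card_mono) auto
    finally have "j \<le> k - d - 1" using j finF S FS by simp
    moreover have "F \<in> G j" using F j S FS by (simp add: G_def)
    ultimately show "F \<in> (\<Union>j\<in>{1..k - d - 1}. G j)" using j by auto
  qed
  then have "card ?D \<le> card (\<Union>j\<in>{1..k - d - 1}. G j)"
    using finG by (intro card_mono) auto
  also have "\<dots> \<le> (\<Sum>j=1..k-d-1. card (G j))" by (rule card_UN_le) simp
  finally have "real (card ?D) \<le> (\<Sum>j=1..k-d-1. real (card (G j)))"
    by (simp flip: of_nat_sum)
  also have "\<dots> \<le> (\<Sum>j=1..k-d-1. N / 8 * (1/2) ^ (j - 1))"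
  proof (intro sum_mono)
    fix j assume j: "j \<in> {1..k - d - 1}"
    have "card (G j) \<le> (card S choose d) * (card (W (2 * j)) choose (j + 1))
        * ((card {1..n} - (d + (j + 1))) choose (k - (d + (j + 1))))"
      unfolding G_def using S W by (intro card_nsets_two_windows_le) auto
    also have "\<dots> \<le> 1 * 4 ^ (j - 1) * ((n - (d + (j + 1))) choose (k - (d + (j + 1))))"
    proof (intro mult_le_mono)
      show "card (W (2 * j)) choose (j + 1) \<le> 4 ^ (j - 1)"
        using j W(2)[of "2 * j"] by (intro le_trans[OF binomial_right_mono central_binomial_upper]) auto
    qed (use S in auto)
    finally have "real (card (G j)) \<le> real (1 * 4 ^ (j - 1)) * real ((n - (d + (j + 1))) choose (k - (d + (j + 1))))"
      unfolding of_nat_mult[symmetric] by (rule of_nat_mono)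
    also have "\<dots> \<le> real (1 * 4 ^ (j - 1)) * ((1 / w) ^ (j + 1 - 1) * N)"
      using j by (intro mult_left_mono choose_le_N) auto
    also have "\<dots> = N * (1 / w) * (4 / w) ^ (j - 1)"
      using j by (cases j) (simp_all add: power_divide)
    also have "\<dots> \<le> N * (1 / 8) * (1/2) ^ (j - 1)"
      using w_ge(1) by (intro mult_mono power_mono) (auto simp: field_simps)
    finally show "real (card (G j)) \<le> N / 8 * (1/2) ^ (j - 1)" by simp
  qed
  also have "\<dots> = N / 8 * (\<Sum>j=1..k-d-1. (1/2) ^ (j - 1))" by (simp add: sum_distrib_left)
  also have "\<dots> \<le> N / 8 * 2"
    using sum_power_tail_le[of "1/2" 1 "k - d - 1"] by (intro mult_left_mono) auto
  finally have "real (4 * card ?D) \<le> real N" by simp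
  then show ?thesis by (simp only: of_nat_le_iff)
qed

text \<open>
  Here \<open>P l\<close> stands for an initial segment. The geometric series has ratio
  \<open>(d + 3) / (4 * d * (d - 1)) \<le> 5 / 8\<close> and sum at most \<open>8 / 3\<close>; that this is below \<open>3\<close> is just enough
  for \<open>d = 2\<close> in the next section.
\<close>

lemma card_prefix_heavy_less:
  assumes P: "\<And>l. P l \<subseteq> {1..n}" "\<And>l. card (P l) \<le> l"
  shows "card {F \<in> nsets {1..n} k. \<exists>j\<ge>1. d + j \<le> card (F \<inter> P (d + 2 * j - 1))} < 3 * N"
    (is "card ?D < _")
proof -
  define G where "G = (\<lambda>j. {F \<in> nsets {1..n} k. d + j \<le> card (F \<inter> P (d + 2 * j - 1))})"
  have finG: "finite (G j)" for j by (simp add: G_def finite_imp_finite_nsets)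
  have "?D \<subseteq> (\<Union>j\<in>{1..k - d}. G j)"
  proof
    fix F assume "F \<in> ?D"
    then obtain j where F: "F \<in> nsets {1..n} k" and j: "1 \<le> j" "d + j \<le> card (F \<inter> P (d + 2 * j - 1))"
      by blast
    have finF: "finite F" "card F = k" using F by (auto simp: nsets_def)
    have "card (F \<inter> P (d + 2 * j - 1)) \<le> card F" using finF by (intro card_mono) auto
    then have "j \<le> k - d" using j finF by simp
    moreover have "F \<in> G j" using F j by (simp add: G_def)
    ultimately show "F \<in> (\<Union>j\<in>{1..k - d}. G j)" using j by auto
  qed
  then have "card ?D \<le> card (\<Union>j\<in>{1..k - d}. G j)"
    using finG by (intro card_mono) auto
  also have "\<dots> \<le> (\<Sum>j=1..k-d. card (G j))" by (rule card_UN_le) simp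
  finally have "real (card ?D) \<le> (\<Sum>j=1..k-d. real (card (G j)))"
    by (simp flip: of_nat_sum)
  also have "\<dots> \<le> (\<Sum>j=1..k-d. N * (5/8) ^ (j - 1))"
  proof (intro sum_mono)
    fix j assume j: "j \<in> {1..k - d}"
    have "card (G j) \<le> (card (P (d + 2 * j - 1)) choose (d + j)) * ((card {1..n} - (d + j)) choose (k - (d + j)))"
      unfolding G_def using P by (intro card_nsets_window_le) auto
    also have "\<dots> \<le> (d + 3) ^ (j - 1) * ((n - (d + j)) choose (k - (d + j)))"
    proof (intro mult_le_mono)
      show "card (P (d + 2 * j - 1)) choose (d + j) \<le> (d + 3) ^ (j - 1)"
        using j P(2)[of "d + 2 * j - 1"] d_ge_2
        by (intro le_trans[OF binomial_right_mono near_full_binomial_upper]) auto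
    qed simp
    finally have "real (card (G j)) \<le> real ((d + 3) ^ (j - 1)) * real ((n - (d + j)) choose (k - (d + j)))"
      unfolding of_nat_mult[symmetric] by (rule of_nat_mono)
    also have "\<dots> \<le> real ((d + 3) ^ (j - 1)) * ((1 / w) ^ (j - 1) * N)"
      using j d_less_k by (intro mult_left_mono choose_le_N) auto
    also have "\<dots> = N * ((d + 3) / w) ^ (j - 1)" by (simp add: power_divide)
    also have "\<dots> \<le> N * (5/8) ^ (j - 1)"
      using w_ge by (intro mult_left_mono power_mono) (auto simp: field_simps)
    finally show "real (card (G j)) \<le> N * (5/8) ^ (j - 1)" .
  qed
  also have "\<dots> = N * (\<Sum>j=1..k-d. (5/8) ^ (j - 1))" by (simp add: sum_distrib_left)
  also have "\<dots> \<le> N * (8/3)"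
    using sum_power_tail_le[of "5/8" 1 "k - d"] by (intro mult_left_mono) auto
  also have "\<dots> < N * 3" using N_pos by simp
  finally have "real (card ?D) < real (3 * N)" by simp
  then show ?thesis by (simp only: of_nat_less_iff)
qed

section \<open>No \<open>d\<close>-set lies in many members\<close>

definition bounded_degree_family :: "nat set set \<Rightarrow> bool" where
  "bounded_degree_family \<G> \<longleftrightarrow> \<G> \<subseteq> nsets {1..n} k \<and> intersecting \<G> \<and> (\<forall>x. d * deg \<G> x \<le> card \<G>)"

lemma finite_bounded_degree_family: "bounded_degree_family \<G> \<Longrightarrow> finite \<G>"
  using finite_subset[OF _ finite_imp_finite_nsets[of "{1..n}" k]]
  by (auto simp: bounded_degree_family_def)

text \<open>
  The total degree of the points of \<open>S\<close> is at most \<open>d * (|\<G>| / d)\<close>. It counts each member that meets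
  \<open>S\<close> at least once and each member over \<open>S\<close> exactly \<open>d\<close> times, so the excess has to be made up by
  members that avoid \<open>S\<close>.
\<close>

lemma card_avoiding_d_set_ge:
  assumes G: "bounded_degree_family \<G>" and S: "finite S" "card S = d"
  shows "(d - 1) * card {F \<in> \<G>. S \<subseteq> F} \<le> card {F \<in> \<G>. F \<inter> S = {}}"
proof -
  have fin: "finite \<G>" using G by (rule finite_bounded_degree_family)
  have "d * (\<Sum>x\<in>S. deg \<G> x) = (\<Sum>x\<in>S. d * deg \<G> x)" by (rule sum_distrib_left)
  also have "\<dots> \<le> (\<Sum>x\<in>S. card \<G>)"
    using G by (intro sum_mono) (auto simp: bounded_degree_family_def)
  also have "\<dots> = d * card \<G>" using S by simp
  finally have "(\<Sum>x\<in>S. deg \<G> x) \<le> card \<G>" using d_ge_2 by simp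
  then have le: "(\<Sum>F\<in>\<G>. card (F \<inter> S)) \<le> card \<G>"
    using sum_deg_eq_sum_card_inter[OF fin S(1)] by simp
  have "(\<Sum>F\<in>\<G>. 1 + (if S \<subseteq> F then d - 1 else 0)) \<le> (\<Sum>F\<in>\<G>. card (F \<inter> S) + (if F \<inter> S = {} then 1 else 0))"
  proof (rule sum_mono)
    fix F
    have "card (F \<inter> S) = d" if "S \<subseteq> F" using that S by (simp add: Int_absorb1)
    moreover have "1 \<le> card (F \<inter> S)" if "F \<inter> S \<noteq> {}"
      using that S by (simp add: Suc_le_eq card_gt_0_iff)
    ultimately show "1 + (if S \<subseteq> F then d - 1 else 0) \<le> card (F \<inter> S) + (if F \<inter> S = {} then 1 else 0)"
      using d_ge_2 by auto
  qed
  also have "(\<Sum>F\<in>\<G>. 1 + (if S \<subseteq> F then d - 1 else 0)) = card \<G> + (d - 1) * card {F \<in> \<G>. S \<subseteq> F}"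
    unfolding sum.distrib using fin by (simp add: sum.If_cases Int_def)
  also have "(\<Sum>F\<in>\<G>. card (F \<inter> S) + (if F \<inter> S = {} then 1 else 0))
      = (\<Sum>F\<in>\<G>. card (F \<inter> S)) + card {F \<in> \<G>. F \<inter> S = {}}"
    using fin by (simp add: sum.distrib sum.If_cases Int_def)
  finally show ?thesis using le by simp
qed

text \<open>
  Otherwise shift the members over \<open>S\<close> and the members avoiding \<open>S\<close> outside \<open>S\<close>, keeping them
  cross-intersecting. At most \<open>d * N\<close> sets over \<open>S\<close> meet the first \<open>d\<close> points, and at most \<open>N / 4\<close> have a
  majority on a later window, so some \<open>A\<close> over \<open>S\<close> does neither. By the prefix lemma each \<open>B\<close> of the other
  family then has \<open>d + j\<close> of the first \<open>d + 2 * j - 1\<close> points for some \<open>j\<close>, which leaves fewer than \<open>3 * N\<close>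
  sets \<open>B\<close>. But there should be more than \<open>(d - 1) * (d + 1) * N\<close>.
\<close>

lemma card_over_d_set_le:
  assumes G: "bounded_degree_family \<G>" and S: "S \<subseteq> {1..n}" "card S = d"
  shows "card {F \<in> \<G>. S \<subseteq> F} \<le> (d + 1) * N"
proof (rule ccontr)
  assume "\<not> ?thesis"
  then have large: "(d + 1) * N < card {F \<in> \<G>. S \<subseteq> F}" by simp
  have finS: "finite S" using S finite_subset by blast
  have sub: "\<G> \<subseteq> nsets {1..n} k" and int: "intersecting \<G>"
    using G by (auto simp: bounded_degree_family_def)
  obtain \<A> \<B> where AB: "\<A> \<subseteq> nsets {1..n} k" "\<B> \<subseteq> nsets {1..n} k" "cross_intersecting \<A> \<B>"
    "\<forall>A\<in>\<A>. S \<subseteq> A" "\<forall>B\<in>\<B>. B \<inter> S = {}"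
    and card_A: "card \<A> = card {F \<in> \<G>. S \<subseteq> F}" and card_B: "card \<B> = card {F \<in> \<G>. F \<inter> S = {}}"
    and sh: "shifted_on ({1..n} - S) \<A>"
  proof (rule ex_shifted_cross_intersecting[of "{1..n}" "{F \<in> \<G>. S \<subseteq> F}" k "{F \<in> \<G>. F \<inter> S = {}}" S])
    show "cross_intersecting {F \<in> \<G>. S \<subseteq> F} {F \<in> \<G>. F \<inter> S = {}}"
      using int by (auto simp: cross_intersecting_def intersecting_def)
  qed (use sub in auto)
  have finA: "finite \<A>" using AB(1) finite_imp_finite_nsets finite_subset by blast
  define R where "R = {1..n} - S"
  have finR: "finite R" by (simp add: R_def)
  define W where "W = (\<lambda>s. first R (d + s) - first R d)"
  have W: "W s \<subseteq> {1..n} - S" "card (W s) \<le> s" for s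
    using first_subset[of R] card_first_diff[OF finR, of d s] by (auto simp: W_def R_def)
  have card_first_le: "card (first R l) \<le> l" for l using card_first[OF finR, of l] by simp
  define M where "M = {F \<in> nsets {1..n} k. d \<le> card (F \<inter> S) \<and> 1 \<le> card (F \<inter> first R d)}"
  define D where "D = {F \<in> nsets {1..n} k. S \<subseteq> F \<and> (\<exists>j\<ge>1. j + 1 \<le> card (F \<inter> W (2 * j)))}"
  have "card M \<le> (card S choose d) * (card (first R d) choose 1) * ((card {1..n} - (d + 1)) choose (k - (d + 1)))"
    unfolding M_def using S first_subset[of R d] by (intro card_nsets_two_windows_le) (auto simp: R_def)
  also have "\<dots> \<le> d * N"
    using S card_first_le[of d] by (simp add: N_def)
  finally have M: "card M \<le> d * N" .
  have "4 * card D \<le> N" unfolding D_def using S W by (rule card_dense_over_le)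
  then have "card (M \<union> D) < card \<A>"
    using M large N_pos card_A card_Un_le[of M D] by simp
  moreover have "finite (M \<union> D)" by (simp add: M_def D_def finite_imp_finite_nsets)
  ultimately have "\<not> \<A> \<subseteq> M \<union> D" using card_mono[of "M \<union> D" \<A>] by linarith
  then obtain A where A: "A \<in> \<A>" "A \<notin> M" "A \<notin> D" by blast
  have A_sub: "A \<in> nsets {1..n} k" "S \<subseteq> A" using A AB by auto
  then have finA: "finite A" by (simp add: nsets_def)
  have "card (A \<inter> S) = d" using A_sub S by (simp add: Int_absorb1)
  then have "card (A \<inter> first R d) = 0" using A A_sub by (simp add: M_def)
  then have A_first: "A \<inter> first R d = {}" using finA by simp
  have A_W: "card (A \<inter> W (2 * j)) \<le> j" if "1 \<le> j" for j
  proof -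
    have "\<forall>j\<ge>1. \<not> j + 1 \<le> card (A \<inter> W (2 * j))" using A A_sub by (simp add: D_def)
    then show ?thesis using that by (simp add: not_le less_Suc_eq_le)
  qed
  have "\<B> \<subseteq> {F \<in> nsets {1..n} k. \<exists>j\<ge>1. d + j \<le> card (F \<inter> first R (d + 2 * j - 1))}"
  proof
    fix B assume B: "B \<in> \<B>"
    have finB: "finite B" using B AB by (auto simp: nsets_def)
    have "A \<inter> B \<subseteq> R" using A_sub B AB(5) by (auto simp: R_def nsets_def)
    then obtain l where l: "l < card (A \<inter> first R l) + card (B \<inter> first R l)"
      using shifted_cross_intersecting_prefix[OF AB(3) sh _ A(1) B] finR unfolding R_def by blast
    have le: "card (B \<inter> first R l) \<le> l"
      using card_first_le[of l] card_mono[of "first R l" "B \<inter> first R l"] finite_subset[OF first_subset finR]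
      by (meson Int_lower2 le_trans)
    have "d < l"
    proof (rule ccontr)
      assume "\<not> d < l"
      then have "A \<inter> first R l = {}" using A_first first_mono[of l d R] by auto
      then show False using l le by simp
    qed
    then obtain s where s: "l = d + s" "1 \<le> s" by (metis add.commute less_imp_add_positive Suc_leI One_nat_def)
    define j where "j = (s + 1) div 2"
    have j: "1 \<le> j" "s = 2 * j \<or> s = 2 * j - 1" using s by (auto simp: j_def)
    have "A \<inter> first R l \<subseteq> A \<inter> W (2 * j)"
      using A_first first_mono[of l "d + 2 * j" R] j s by (auto simp: W_def)
    then have "card (A \<inter> first R l) \<le> j"
      using A_W[OF j(1)] card_mono[of "A \<inter> W (2 * j)" "A \<inter> first R l"] finA by simp
    then have Bl: "d + s + 1 \<le> j + card (B \<inter> first R l)" using l s by simp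
    (* for even s one point may be dropped, at the cost of at most one point of B *)
    have "d + j \<le> card (B \<inter> first R (d + 2 * j - 1))"
      using j(2)
    proof
      assume "s = 2 * j - 1"
      then show ?thesis using Bl s j by simp
    next
      assume s2: "s = 2 * j"
      let ?l = "d + 2 * j - 1"
      have "B \<inter> first R l \<subseteq> (B \<inter> first R ?l) \<union> (first R (?l + 1) - first R ?l)"
        using s s2 j by auto
      then have "card (B \<inter> first R l) \<le> card ((B \<inter> first R ?l) \<union> (first R (?l + 1) - first R ?l))"
        using finB finite_subset[OF first_subset finR] by (intro card_mono) auto
      also have "\<dots> \<le> card (B \<inter> first R ?l) + 1"
        using card_Un_le[of "B \<inter> first R ?l" "first R (?l + 1) - first R ?l"] card_first_diff[OF finR, of ?l 1]
        by linarith
      finally show ?thesis using Bl s2 j by simp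
    qed
    then show "B \<in> {F \<in> nsets {1..n} k. \<exists>j\<ge>1. d + j \<le> card (F \<inter> first R (d + 2 * j - 1))}"
      using B AB j by blast
  qed
  then have "card \<B> \<le> card {F \<in> nsets {1..n} k. \<exists>j\<ge>1. d + j \<le> card (F \<inter> first R (d + 2 * j - 1))}"
    by (intro card_mono) (simp_all add: finite_imp_finite_nsets)
  also have "\<dots> < 3 * N"
    using first_subset[of R] card_first_le by (intro card_prefix_heavy_less) (auto simp: R_def)
  finally have "card \<B> < 3 * N" .
  moreover have "(d - 1) * ((d + 1) * N) \<le> (d - 1) * card {F \<in> \<G>. S \<subseteq> F}"
    using large by (intro mult_le_mono2) simp
  moreover have "(d - 1) * card {F \<in> \<G>. S \<subseteq> F} \<le> card \<B>"
    unfolding card_B using G finS S(2) by (rule card_avoiding_d_set_ge)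
  moreover have "3 * N \<le> (d - 1) * ((d + 1) * N)"
  proof -
    have "1 * 3 \<le> (d - 1) * (d + 1)" using d_ge_2 by (intro mult_le_mono) auto
    then show ?thesis unfolding mult.assoc[symmetric] by (intro mult_le_mono1) simp
  qed
  ultimately show False by linarith
qed

lemma sum_choose_le:
  assumes G: "bounded_degree_family \<G>" and Y: "Y \<subseteq> {1..n}"
  shows "(\<Sum>F\<in>\<G>. card (F \<inter> Y) choose d) \<le> (card Y choose d) * ((d + 1) * N)"
proof -
  have finY: "finite Y" using Y finite_subset by blast
  have "(\<Sum>F\<in>\<G>. card (F \<inter> Y) choose d) = (\<Sum>S\<in>nsets Y d. card {F \<in> \<G>. S \<subseteq> F})"
    by (rule sum_choose_card_inter[OF finite_bounded_degree_family[OF G] finY])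
  also have "\<dots> \<le> (\<Sum>S\<in>nsets Y d. (d + 1) * N)"
    using Y by (intro sum_mono card_over_d_set_le[OF G]) (auto simp: nsets_def)
  finally show ?thesis by simp
qed

section \<open>Shifting as long as degrees stay bounded\<close>

text \<open>
  The hypothesis on the size of the family reads \<open>d * T * N \<le> |\<F>|\<close>.
\<close>

definition T :: nat where "T = (2 * d\<^sup>2) ^ d"

text \<open>
  For \<open>d \<ge> 3\<close> the last two bounds follow from \<open>(m choose d) * d! \<le> m ^ d\<close> and \<open>d + 1 \<le> d!\<close>. For
  \<open>d = 2\<close> the latter fails, but then \<open>T = 64\<close>, and the left hand sides are \<open>56\<close> and \<open>45\<close>.
\<close>

lemma T_ge:
  "8 * ((2 * d\<^sup>2) choose (d - 1)) \<le> T"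
  "4 * ((2 * d) choose (d + 1)) \<le> T"
  "2 * ((2 * d\<^sup>2) choose d) < T"
  "(d + 1) * ((2 * (d * (d - 1) + 1)) choose d) < T"
proof -
  define t where "t = 2 * d\<^sup>2"
  have d2: "2 * 2 \<le> d\<^sup>2" unfolding power2_eq_square using d_ge_2 by (intro mult_le_mono)
  then have t8: "8 \<le> t" by (simp add: t_def)
  have "d \<le> d\<^sup>2" unfolding power2_eq_square by (rule le_square)
  then have dt: "d \<le> t" by (simp add: t_def)
  have Tt: "T = t * t ^ (d - 1)" using d_ge_2 by (simp add: T_def t_def power_eq_if)
  have "8 * (t choose (d - 1)) \<le> t * t ^ (d - 1)"
    using t8 dt by (intro mult_le_mono binomial_le_pow) auto
  then show "8 * ((2 * d\<^sup>2) choose (d - 1)) \<le> T" unfolding Tt t_def .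
  have "4 * ((2 * d) choose (d + 1)) \<le> t * t ^ (d - 1)"
  proof (rule mult_le_mono)
    have "(2 * d) choose (d + 1) \<le> 4 ^ (d - 1)" using d_ge_2 by (intro central_binomial_upper) auto
    also have "\<dots> \<le> t ^ (d - 1)" using t8 by (intro power_mono) auto
    finally show "(2 * d) choose (d + 1) \<le> t ^ (d - 1)" .
  qed (use t8 in simp)
  then show "4 * ((2 * d) choose (d + 1)) \<le> T" unfolding Tt .
  have Tpos: "0 < T" using t8 by (auto simp: T_def t_def)
  have "2 * (t choose d) < T \<and> (d + 1) * ((2 * (d * (d - 1) + 1)) choose d) < T"
  proof (cases "d = 2")
    case True
    have "(8::nat) choose 2 = 28" "(6::nat) choose 2 = 15" by (simp_all add: choose_two)
    moreover have "T = 64" unfolding T_def unfolding True by simp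
    ultimately show ?thesis by (simp add: t_def True)
  next
    case False
    then have d3: "3 \<le> d" using d_ge_2 by simp
    then have fd: "d + 1 \<le> fact d"
    proof (induction d rule: dec_induct)
      case base show ?case by (simp add: fact_numeral)
    next
      case (step m)
      have "Suc m + 1 \<le> Suc m * (m + 1)" using step.hyps by simp
      also have "\<dots> \<le> Suc m * fact m" using step.IH by (intro mult_le_mono2)
      finally show ?case by simp
    qed
    have "(t choose d) * 4 \<le> (t choose d) * fact d" using fd d3 by (intro mult_le_mono2) linarith
    also have "\<dots> \<le> T" using binomial_fact_pow[of t d] by (simp add: T_def t_def)
    finally have one: "2 * (t choose d) < T" using Tpos by linarith
    let ?s = "2 * (d * (d - 1) + 1)"
    have "(d + 1) * (?s choose d) \<le> fact d * (?s choose d)" using fd by (rule mult_le_mono1)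
    also have "\<dots> \<le> ?s ^ d" using binomial_fact_pow[of ?s d] by (simp only: mult.commute)
    also have "\<dots> < t ^ d"
    proof (rule power_strict_mono)
      obtain e where "d = e + 2" using d_ge_2 by (metis add.commute le_Suc_ex)
      then show "?s < t" by (simp add: t_def power2_eq_square algebra_simps)
    qed (use d_ge_2 in auto)
    finally show ?thesis using one by (simp add: T_def t_def)
  qed
  then show "2 * ((2 * d\<^sup>2) choose d) < T" "(d + 1) * ((2 * (d * (d - 1) + 1)) choose d) < T"
    by (simp_all add: t_def)
qed

text \<open>
  The points of \<open>X\<close> have average degree at least \<open>|\<G>| / (2 * d)\<close>, so members meet \<open>X\<close> in at least
  \<open>d - 1 + 1 / d\<close> points on average. Hence they contain at least \<open>|\<G>| / d\<close> of its \<open>d\<close>-subsets, counted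
  with multiplicity, which is more than the bound for single \<open>d\<close>-sets allows.
\<close>

lemma not_all_heavy:
  assumes G: "bounded_degree_family \<G>" and large: "d * T * N \<le> card \<G>"
    and X: "X \<subseteq> {1..n}" "card X = 2 * (d * (d - 1) + 1)"
    and heavy: "(d * (d - 1) + 1) * card \<G> \<le> d * (\<Sum>x\<in>X. deg \<G> x)"
  shows False
proof -
  have fin: "finite \<G>" using G by (rule finite_bounded_degree_family)
  have finX: "finite X" using X finite_subset by blast
  have "d * (\<Sum>x\<in>X. deg \<G> x) = d * (\<Sum>F\<in>\<G>. card (F \<inter> X))"
    using sum_deg_eq_sum_card_inter[OF fin finX] by simp
  also have "\<dots> \<le> d * (\<Sum>F\<in>\<G>. (d - 1) + (card (F \<inter> X) choose d))"
    using d_ge_2 by (intro mult_le_mono2 sum_mono le_pred_plus_choose) auto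
  also have "\<dots> = d * (d - 1) * card \<G> + d * (\<Sum>F\<in>\<G>. card (F \<inter> X) choose d)"
    by (simp add: sum.distrib algebra_simps)
  finally have "card \<G> \<le> d * (\<Sum>F\<in>\<G>. card (F \<inter> X) choose d)"
    using heavy unfolding distrib_right by linarith
  also have "\<dots> \<le> d * ((card X choose d) * ((d + 1) * N))"
    using sum_choose_le[OF G X(1)] by (rule mult_le_mono2)
  also have "\<dots> = d * (((d + 1) * (card X choose d)) * N)" by (simp only: ac_simps)
  also have "\<dots> < d * (T * N)"
    using T_ge(4) N_pos d_ge_2 unfolding X(2) by (intro mult_strict_left_mono mult_strict_right_mono) auto
  also have "\<dots> \<le> card \<G>" using large by (simp only: mult.assoc)
  finally show False by simp
qed

text \<open>
  Let \<open>A\<close> and \<open>H\<close> be members with disjoint traces on \<open>Y\<close>. The prefix lemma needs more than \<open>l\<close> points of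
  \<open>A\<close> and \<open>H\<close> among the first \<open>l\<close>. As the traces are disjoint, \<open>l\<close> exceeds \<open>2 * d\<close>, and the points that the
  traces leave unused among the first \<open>2 * d\<close> have to be made up in the window behind them. If \<open>A\<close> meets
  \<open>Y\<close> in \<open>p < d\<close> points and is not dense, it has fewer than \<open>j + (d - p)\<close> points in the window of
  length \<open>2 * j\<close>. The rest has to come from \<open>H\<close>, which makes \<open>H\<close> dense, unless \<open>H\<close> itself uses more
  than \<open>d\<close> of the first \<open>2 * d\<close> points.
\<close>

lemma not_shifted_outside:
  assumes G: "bounded_degree_family \<G>" and large: "d * T * N \<le> card \<G>"
    and X: "X \<subseteq> {1..n}" "card X \<le> 2 * (d * (d - 1))"
    and sh: "shifted_on ({1..n} - X) \<G>"
  shows False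
proof -
  have fin: "finite \<G>" using G by (rule finite_bounded_degree_family)
  have sub: "\<G> \<subseteq> nsets {1..n} k" and cross: "cross_intersecting \<G> \<G>" and degs: "d * deg \<G> x \<le> card \<G>" for x
    using G by (auto simp: bounded_degree_family_def intersecting_iff_cross)
  have finF: "finite F" "F \<subseteq> {1..n}" if "F \<in> \<G>" for F using that sub by (auto simp: nsets_def)
  define R where "R = {1..n} - X"
  have finR: "finite R" by (simp add: R_def)
  have fin_first: "finite (first R l)" for l by (rule finite_subset[OF first_subset finR])
  have card_first_le: "card (first R l) \<le> l" for l using card_first[OF finR, of l] by simp
  define Q where "Q = first R (2 * d)"
  define W where "W = (\<lambda>s. first R (2 * d + s) - Q)"
  define Y where "Y = X \<union> Q"
  have Y: "Y \<subseteq> {1..n}" using X first_subset[of R] by (auto simp: Y_def Q_def R_def)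
  have "card Y \<le> card X + card Q" unfolding Y_def by (rule card_Un_le)
  also have "\<dots> \<le> 2 * (d * (d - 1)) + 2 * d" using X(2) card_first_le[of "2 * d"] by (simp add: Q_def)
  also have "\<dots> = 2 * d\<^sup>2" using d_ge_2 by (cases d) (simp_all add: power2_eq_square)
  finally have card_Y: "card Y \<le> 2 * d\<^sup>2" .
  have finY: "finite Y" using Y finite_subset by blast
  have W: "W s \<subseteq> {1..n} - Y" "card (W s) \<le> s" for s
    using first_subset[of R] card_first_diff[OF finR, of "2 * d" s] by (auto simp: W_def Y_def R_def Q_def)
  have finW: "finite (W s)" for s by (simp add: W_def fin_first)
  define D where "D = {F \<in> nsets {1..n} k. \<exists>j\<ge>1. j + max 1 (d - card (F \<inter> Y)) \<le> card (F \<inter> W (2 * j))}"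
  have card_D: "card D \<le> 4 * ((2 * d\<^sup>2) choose (d - 1)) * N"
    unfolding D_def using Y card_Y W by (rule card_dense_le)
  have "8 * ((2 * d\<^sup>2) choose (d - 1)) * N \<le> T * N" using T_ge(1) by (rule mult_le_mono1)
  with card_D have card_D2: "2 * card D \<le> T * N" by linarith
  (* the exceptional sets, which are pinned down in d + 1 points of Q *)
  define E where "E = {F \<in> nsets {1..n} k. d + 1 \<le> card (F \<inter> Q)}"
  have "card E \<le> (card Q choose (d + 1)) * ((card {1..n} - (d + 1)) choose (k - (d + 1)))"
    unfolding E_def using Y by (intro card_nsets_window_le) (auto simp: Y_def)
  also have "\<dots> \<le> ((2 * d) choose (d + 1)) * N"
    using card_first_le[of "2 * d"] by (intro mult_le_mono binomial_right_mono) (auto simp: Q_def N_def)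
  finally have "4 * card E \<le> 4 * ((2 * d) choose (d + 1)) * N" by simp
  also have "\<dots> \<le> T * N" using T_ge(2) by (rule mult_le_mono1)
  finally have card_E: "4 * card E \<le> T * N" .
  have finDE: "finite (D \<union> E)" by (simp add: D_def E_def finite_imp_finite_nsets)

  have in_D: "A \<in> D" if A: "A \<in> \<G>" and small: "card (A \<inter> Y) < d" for A
  proof (rule ccontr)
    assume "A \<notin> D"
    define p where "p = card (A \<inter> Y)"
    have A_W: "card (A \<inter> W (2 * j)) < j + (d - p)" if "1 \<le> j" for j
    proof -
      have "\<forall>j\<ge>1. \<not> j + max 1 (d - p) \<le> card (A \<inter> W (2 * j))"
        using \<open>A \<notin> D\<close> subsetD[OF sub A] by (simp add: D_def p_def)
      then have "card (A \<inter> W (2 * j)) < j + max 1 (d - p)" using that not_le by blast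
      then show ?thesis using small by (simp add: p_def)
    qed
    (* at least card \<G> / d members avoid the trace of A, and all of them are dense or exceptional *)
    have "{H \<in> \<G>. H \<inter> (A \<inter> Y) = {}} \<subseteq> D \<union> E"
    proof
      fix H assume "H \<in> {H \<in> \<G>. H \<inter> (A \<inter> Y) = {}}"
      then have H: "H \<in> \<G>" "H \<inter> A \<inter> Y = {}" by auto
      show "H \<in> D \<union> E"
      proof (cases "d + 1 \<le> card (H \<inter> Q)")
        case True
        then show ?thesis using H sub by (auto simp: E_def)
      next
        case False
        have "A \<inter> H \<subseteq> R" using H finF[OF H(1)] by (auto simp: R_def Y_def)
        then obtain l where l: "l < card (A \<inter> first R l) + card (H \<inter> first R l)"
          using shifted_cross_intersecting_prefix[OF cross sh _ A H(1)] finR unfolding R_def by blast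
        have "2 * d < l"
        proof (rule ccontr)
          assume "\<not> 2 * d < l"
          then have "first R l \<subseteq> Y" using first_mono[of l "2 * d" R] by (auto simp: Y_def Q_def)
          then have "card (A \<inter> first R l) + card (H \<inter> first R l) = card (A \<inter> first R l \<union> H \<inter> first R l)"
            using H fin_first by (intro card_Un_disjoint[symmetric]) auto
          also have "\<dots> \<le> card (first R l)" using fin_first by (intro card_mono) auto
          also have "\<dots> \<le> l" by (rule card_first_le)
          finally show False using l by simp
        qed
        then obtain s where s: "l = 2 * d + s" "1 \<le> s"
          by (metis add.commute less_imp_add_positive Suc_leI One_nat_def)
        define j where "j = (s + 1) div 2"
        have j: "1 \<le> j" "s \<le> 2 * j" "2 * j \<le> s + 1" using s by (auto simp: j_def)
        have split: "card (F \<inter> first R l) \<le> card (F \<inter> Q) + card (F \<inter> W (2 * j))" for F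
        proof -
          have "F \<inter> first R l \<subseteq> F \<inter> Q \<union> F \<inter> W (2 * j)"
            using first_mono[of l "2 * d + 2 * j" R] s j by (auto simp: W_def)
          then have "card (F \<inter> first R l) \<le> card (F \<inter> Q \<union> F \<inter> W (2 * j))"
            using fin_first finW by (intro card_mono) (auto simp: Q_def)
          then show ?thesis using card_Un_le le_trans by blast
        qed
        have "card (A \<inter> Q) \<le> p"
          unfolding p_def using finY by (intro card_mono) (auto simp: Y_def)
        moreover have "card (H \<inter> Q) \<le> card (H \<inter> Y)"
          using finY by (intro card_mono) (auto simp: Y_def)
        moreover have "d - p + p = d" "d - card (H \<inter> Q) + card (H \<inter> Q) = d"
          using small False by (simp_all add: p_def)
        moreover have "d - card (H \<inter> Q) + j + 1 \<le> card (H \<inter> W (2 * j))"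
          using A_W[OF j(1)] split[of A] split[of H] l s j calculation by linarith
        ultimately have "j + max 1 (d - card (H \<inter> Y)) \<le> card (H \<inter> W (2 * j))" by linarith
        then show ?thesis using H sub j(1) by (auto simp: D_def)
      qed
    qed
    then have "card {H \<in> \<G>. H \<inter> (A \<inter> Y) = {}} \<le> card (D \<union> E)" using finDE by (rule card_mono[rotated])
    then have le: "card {H \<in> \<G>. H \<inter> (A \<inter> Y) = {}} \<le> card D + card E" using card_Un_le le_trans by blast
    have "card {H \<in> \<G>. H \<inter> (A \<inter> Y) \<noteq> {}} \<le> card (\<Union>x\<in>A \<inter> Y. {F \<in> \<G>. x \<in> F})"
      using fin finY by (intro card_mono) auto
    also have "\<dots> \<le> (\<Sum>x\<in>A \<inter> Y. deg \<G> x)"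
      unfolding deg_def using finY by (intro card_UN_le) auto
    finally have "d * card {H \<in> \<G>. H \<inter> (A \<inter> Y) \<noteq> {}} \<le> d * (\<Sum>x\<in>A \<inter> Y. deg \<G> x)" by simp
    also have "\<dots> \<le> (\<Sum>x\<in>A \<inter> Y. card \<G>)" unfolding sum_distrib_left using degs by (intro sum_mono)
    also have "\<dots> = card (A \<inter> Y) * card \<G>" by simp
    also have "\<dots> \<le> (d - 1) * card \<G>" using small by (intro mult_le_mono1) simp
    finally have hit: "d * card {H \<in> \<G>. H \<inter> (A \<inter> Y) \<noteq> {}} \<le> (d - 1) * card \<G>" .
    have "card \<G> = card ({H \<in> \<G>. H \<inter> (A \<inter> Y) = {}} \<union> {H \<in> \<G>. H \<inter> (A \<inter> Y) \<noteq> {}})"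
      by (rule arg_cong[of _ _ card]) auto
    also have "\<dots> \<le> card {H \<in> \<G>. H \<inter> (A \<inter> Y) = {}} + card {H \<in> \<G>. H \<inter> (A \<inter> Y) \<noteq> {}}"
      by (rule card_Un_le)
    finally have "d * card \<G> \<le> d * card {H \<in> \<G>. H \<inter> (A \<inter> Y) = {}} + d * card {H \<in> \<G>. H \<inter> (A \<inter> Y) \<noteq> {}}"
      unfolding distrib_left[symmetric] by (rule mult_le_mono2)
    also have "\<dots> \<le> d * (card D + card E) + (d - 1) * card \<G>"
      by (intro add_le_mono mult_le_mono2 le hit)
    finally have "d * card \<G> \<le> d * (card D + card E) + (d - 1) * card \<G>" .
    then have "card \<G> \<le> d * (card D + card E)"
      using d_ge_2 by (cases d) auto
    also have "\<dots> < d * (T * N)"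
    proof (rule mult_strict_left_mono)
      have "0 < T * N" using T_ge(3) N_pos by simp
      then show "card D + card E < T * N" using card_D2 card_E by linarith
    qed (use d_ge_2 in simp)
    finally show False using large by (simp add: mult.assoc)
  qed
  have "card \<G> = card ({F \<in> \<G>. card (F \<inter> Y) < d} \<union> {F \<in> \<G>. d \<le> card (F \<inter> Y)})"
    by (rule arg_cong[of _ _ card]) auto
  also have "\<dots> \<le> card {F \<in> \<G>. card (F \<inter> Y) < d} + card {F \<in> \<G>. d \<le> card (F \<inter> Y)}"
    by (rule card_Un_le)
  also have "card {F \<in> \<G>. card (F \<inter> Y) < d} \<le> card D"
    using in_D finDE by (intro card_mono) auto
  also have "card {F \<in> \<G>. d \<le> card (F \<inter> Y)} \<le> (\<Sum>F\<in>\<G>. card (F \<inter> Y) choose d)"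
  proof -
    have "card {F \<in> \<G>. d \<le> card (F \<inter> Y)} = (\<Sum>F\<in>{F \<in> \<G>. d \<le> card (F \<inter> Y)}. 1)" by simp
    also have "\<dots> \<le> (\<Sum>F\<in>{F \<in> \<G>. d \<le> card (F \<inter> Y)}. card (F \<inter> Y) choose d)"
      by (intro sum_mono) (auto simp: Suc_le_eq)
    also have "\<dots> \<le> (\<Sum>F\<in>\<G>. card (F \<inter> Y) choose d)" using fin by (intro sum_mono2) auto
    finally show ?thesis .
  qed
  also have "\<dots> \<le> (card Y choose d) * ((d + 1) * N)" by (rule sum_choose_le[OF G Y])
  also have "\<dots> \<le> ((2 * d\<^sup>2) choose d) * ((d + 1) * N)"
    using card_Y by (intro mult_le_mono1 binomial_right_mono)
  finally have "card \<G> \<le> card D + ((2 * d\<^sup>2) choose d) * ((d + 1) * N)" by simp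
  then have "2 * card \<G> \<le> 2 * card D + (d + 1) * (2 * ((2 * d\<^sup>2) choose d)) * N"
    by (simp add: algebra_simps)
  also have "\<dots> < T * N + (d + 1) * T * N"
    using card_D2 T_ge(3) N_pos by (intro add_le_less_mono mult_strict_right_mono mult_strict_left_mono) auto
  also have "\<dots> = (d + 2) * (T * N)" by (simp add: algebra_simps)
  also have "\<dots> \<le> (2 * d) * (T * N)" using d_ge_2 by (intro mult_le_mono1) simp
  finally show False using large by (simp add: mult.assoc)
qed

text \<open>
  Candidates are families \<open>\<G>\<close> of the same size as \<open>\<F>\<close> that keep the degree bound, together with a set
  \<open>X\<close> of \<open>2 * m\<close> points of average degree at least \<open>|\<F>| / (2 * d)\<close>. Take the last \<open>m\<close> before candidates
  cease to exist, and a candidate of least weight for it. A shift outside \<open>X\<close> does not affect the degrees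
  of \<open>X\<close>; so if it changes \<open>\<G>\<close>, it has to break the degree bound. Only the degree of \<open>i\<close> can become too
  large, which means that \<open>i\<close> and \<open>j\<close> could have been added to \<open>X\<close>. So \<open>\<G>\<close> is shifted outside \<open>X\<close>.
\<close>

theorem no_large_bounded_degree_family:
  assumes "bounded_degree_family \<F>" and "d * T * N \<le> card \<F>"
  shows False
proof -
  define m0 where "m0 = d * (d - 1) + 1"
  define P where "P = (\<lambda>m (\<G>, X). bounded_degree_family \<G> \<and> card \<G> = card \<F> \<and> X \<subseteq> {1..n} \<and>
    card X = 2 * m \<and> m * card \<F> \<le> d * (\<Sum>x\<in>X. deg \<G> x))"
  have P0: "P 0 (\<F>, {})" using assms(1) by (simp add: P_def)
  have not_P_m0: "\<not> P m0 (\<G>, X)" for \<G> X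
    using not_all_heavy[of \<G> X] assms(2) by (auto simp: P_def m0_def)
  have "\<exists>m<m0. (\<exists>p. P m p) \<and> (\<nexists>p. P (Suc m) p)"
  proof (rule ccontr)
    assume neg: "\<not> ?thesis"
    have "\<exists>p. P m p" if "m \<le> m0" for m
      using that
    proof (induction m)
      case 0
      show ?case using P0 by (rule exI)
    next
      case (Suc m)
      then have "\<exists>p. P m p" "m < m0" by auto
      with neg show ?case by blast
    qed
    then show False using not_P_m0 by auto
  qed
  then obtain m where m: "m < m0" "\<exists>p. P m p" "\<nexists>p. P (Suc m) p" by blast
  obtain p where p: "P m p" "\<And>q. P m q \<Longrightarrow> weight (fst p) \<le> weight (fst q)"
    using m(2) ex_has_least_nat[of "P m" _ "\<lambda>p. weight (fst p)"] by blast
  obtain \<G> X where p_eq: "p = (\<G>, X)" by force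
  have G: "bounded_degree_family \<G>" "card \<G> = card \<F>" and X: "X \<subseteq> {1..n}" "card X = 2 * m"
    "m * card \<F> \<le> d * (\<Sum>x\<in>X. deg \<G> x)"
    using p(1) by (auto simp: P_def p_eq)
  have fin: "finite \<G>" "\<And>F. F \<in> \<G> \<Longrightarrow> finite F"
    using G(1) finite_bounded_degree_family by (auto simp: bounded_degree_family_def nsets_def)
  have finX: "finite X" using X finite_subset by blast
  have "insert i (F - {j}) \<in> \<G>"
    if F: "F \<in> \<G>" and ij: "i \<in> {1..n} - X" "j \<in> {1..n} - X" "i < j" "j \<in> F" "i \<notin> F" for F i j
  proof (rule ccontr)
    assume "insert i (F - {j}) \<notin> \<G>"
    then have less: "weight (shift i j \<G>) < weight \<G>" using F ij fin by (intro weight_shift_less) auto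
    have deg_X: "(\<Sum>x\<in>X. deg (shift i j \<G>) x) = (\<Sum>x\<in>X. deg \<G> x)"
      using ij by (intro sum.cong deg_shift_other) auto
    show False
    proof (cases "d * deg (shift i j \<G>) i \<le> card \<F>")
      case True
      have "d * deg (shift i j \<G>) x \<le> card \<F>" for x
      proof (cases "x = i")
        case False
        have "d * deg (shift i j \<G>) x \<le> d * deg \<G> x"
          using deg_shift_le[OF fin(1) False] by (rule mult_le_mono2)
        also have "\<dots> \<le> card \<F>" using G by (simp add: bounded_degree_family_def)
        finally show ?thesis .
      qed (use True in simp)
      then have "bounded_degree_family (shift i j \<G>)"
        using G ij by (simp add: bounded_degree_family_def shift_subset_nsets card_shift
            intersecting_iff_cross cross_intersecting_shift)
      then have "P m (shift i j \<G>, X)" using G X deg_X by (simp add: P_def card_shift)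
      then show False using p(2)[of "(shift i j \<G>, X)"] less by (simp add: p_eq)
    next
      case False
      have "card \<F> \<le> d * (deg \<G> i + deg \<G> j)"
        using False mult_le_mono2[OF deg_shift_target_le[OF fin(1), of i j], of d] by linarith
      moreover have "(\<Sum>x\<in>insert i (insert j X). deg \<G> x) = deg \<G> i + deg \<G> j + (\<Sum>x\<in>X. deg \<G> x)"
        using finX ij by simp
      ultimately have "Suc m * card \<F> \<le> d * (\<Sum>x\<in>insert i (insert j X). deg \<G> x)"
        using X(3) by (simp add: algebra_simps)
      moreover have "card (insert i (insert j X)) = 2 * Suc m" using finX ij X(2) by simp
      ultimately have "P (Suc m) (\<G>, insert i (insert j X))" using G X ij by (simp add: P_def)
      then show False using m(3) by blast
    qed
  qed
  then have "shifted_on ({1..n} - X) \<G>" unfolding shifted_on_def by blast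
  moreover have "card X \<le> 2 * (d * (d - 1))" using X(2) m(1) by (simp add: m0_def)
  ultimately show False using not_shifted_outside[OF G(1) _ X(1)] assms(2) G(2) by simp
qed

end

lemma card_link: "card (link \<F> i) = deg \<F> i"
proof -
  have "link \<F> i = (\<lambda>F. F - {i}) ` {F \<in> \<F>. i \<in> F}" by (auto simp: link_def)
  moreover have "inj_on (\<lambda>F. F - {i}) {F \<in> \<F>. i \<in> F}" by (rule inj_onI) blast
  ultimately show ?thesis by (simp add: card_image deg_def)
qed

theorem theorem1p5:
  fixes n k d :: nat and \<F> :: "nat set set"
  assumes "d < k" and "2 \<le> d" and "4 * (d - 1) * d * k \<le> n"
    and "\<F> \<subseteq> nsets {1..n} k"
    and "intersecting \<F>"
    and "2 ^ d * d ^ (2 * d + 1) * ((n - d - 1) choose (k - d - 1)) \<le> card \<F>"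
  shows "varrho n \<F> > 1 / real d"
proof (rule ccontr)
  interpret large_ground_set n k d by unfold_locales (use assms in auto)
  have dTN: "2 ^ d * d ^ (2 * d + 1) * ((n - d - 1) choose (k - d - 1)) = d * T * N"
    by (simp add: T_def N_def power_mult_distrib power_add flip: power_mult)
  have "0 < d * T * N" using T_ge(3) N_pos d_ge_2 by simp
  then have pos: "0 < card \<F>" using assms(6) dTN by linarith
  assume "\<not> varrho n \<F> > 1 / real d"
  then have varrho: "varrho n \<F> \<le> 1 / real d" by simp
  have "d * deg \<F> x \<le> card \<F>" for x
  proof (cases "x \<in> {1..n}")
    case True
    then have "real (card (link \<F> x)) / real (card \<F>) \<le> varrho n \<F>"
      unfolding varrho_def by (intro Max_ge) auto
    then have "real (deg \<F> x) / real (card \<F>) \<le> 1 / real d" using varrho card_link[of \<F> x] by simp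
    then have "real (d * deg \<F> x) \<le> real (card \<F>)" using pos d_ge_2 by (simp add: field_simps)
    then show ?thesis by (simp only: of_nat_le_iff)
  next
    case False
    then have "{F \<in> \<F>. x \<in> F} = {}" using assms(4) unfolding nsets_def by blast
    then show ?thesis unfolding deg_def by (simp only: card.empty mult_0_right le0)
  qed
  then have "bounded_degree_family \<F>" using assms(4,5) by (simp add: bounded_degree_family_def)
  then show False using assms(6) unfolding dTN by (rule no_large_bounded_degree_family)
qed

end
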